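(* Let $\boldsymbol n=(n_1,n_2)\in\mathbb Z_{\ge0}^2$, and let $P_{\boldsymbol n}$ be a monic polynomial of degree $N=n_1+n_2$ (assuming it exists) that satisfies the multiple orthogonality conditions $$\int_{\Delta_i}x^jP_{\boldsymbol n}(x)w_i(x)\,dx\begin{cases}=0,&j\le n_i-1,\\ \ne0,&j=n_i,\end{cases}\qquad i=1,2.$$ Then $S_{\boldsymbol n,i}=\mathfrak D_{w_i}[P_{\boldsymbol n}]$ are polynomials of degree at most $N-n_i+\sigma_i$, $i=1,2$, and there exist polynomials $C_{\boldsymbol n,i}$ with $$\deg(C_{\boldsymbol n,i})\le N-n_i+2\sigma_i,\qquad i=1,2,$$ such that $P_{\boldsymbol n}$ is a solution of the system of linear differential equations $$A_iS_{\boldsymbol n,i}\,y''+(A_i'S_{\boldsymbol n,i}-A_iS_{\boldsymbol n,i}'+B_iS_{\boldsymbol n,i})\,y'+C_{\boldsymbol n,i}\,y=0,\qquad i=1,2.$$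
   Context: Two semiclassical weights. For $i=1,2$: $A_i$ (monic) and $B_i$ are real polynomials; $\Delta_i\subset\mathbb R$ is a finite union of non-overlapping intervals joining real zeros of $A_i$ and possibly $\infty$ (with no zero of $A_i$ in the interior of these intervals); $w_i(z)=\exp\left(\int^z\frac{B_i(t)}{A_i(t)}dt\right)$ is a (multivalued) analytic function, and on each interval of $\Delta_i$ the weight, also denoted $w_i$, is positive and coincides up to a non-zero multiplicative constant with a boundary value $(w_i)_+$ of this function. Thus $w_i'/w_i=B_i/A_i$. Put $v_i=A_iw_i$. All moments are finite: $\int_{\Delta_i}|x|^m|w_i(x)|dx<+\infty$, $m=0,1,2,\dots$; as a consequence $z^mv_i(z)=0$ (in the limit sense) at the endpoints of every subinterval of $\Delta_i$. Put $\sigma_i=\max\{\deg(A_i)-2,\deg(B_i)-1\}$, assumed $\ge0$. Cauchy transform: $\mathfrak C_{w_i}[f](z)=\int_{\Delta_i}\frac{f(t)w_i(t)}{t-z}dt$. Functions of the second kind: $q_{\boldsymbol n,i}=\mathfrak C_{w_i}[P_{\boldsymbol n}]/w_i$. Electrostatic partners of $P_{\boldsymbol n}$: $$S_{\boldsymbol n,i}=\mathfrak D_{w_i}[P_{\boldsymbol n}]:=\det\begin{pmatrix}P_{\boldsymbol n}&\mathfrak C_{w_i}[P_{\boldsymbol n}]\\ A_iP_{\boldsymbol n}'&A_i(\mathfrak C_{w_i}[P_{\boldsymbol n}])'-B_i\,\mathfrak C_{w_i}[P_{\boldsymbol n}]\end{pmatrix}=v_i\,(P_{\boldsymbol n}q_{\boldsymbol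 n,i}'-P_{\boldsymbol n}'q_{\boldsymbol n,i}).$$ Standing assumption: the $3\times3$ Wronskian $\mathfrak{Wrons}[P_{\boldsymbol n},q_{\boldsymbol n,1},q_{\boldsymbol n,2}]\not\equiv0$. *)

theory Defs
  imports "HOL-Analysis.Analysis" "HOL-Computational_Algebra.Polynomial"
begin

abbreviation cpoly :: "real poly \<Rightarrow> complex poly" where
  "cpoly p \<equiv> map_poly complex_of_real p"

text \<open>The multivalued function \<open>exp (\<integral> B/A)\<close> is handled through its single-valued
  branches \<open>W\<close> on domains \<open>U\<close>. Two branches on the same \<open>U\<close> differ by a non-zero constant factor.\<close>

definition semiclassical_branch ::
    "real poly \<Rightarrow> real poly \<Rightarrow> complex set \<Rightarrow> (complex \<Rightarrow> complex) \<Rightarrow> bool" where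
  "semiclassical_branch A B U W \<longleftrightarrow>
     open U \<and> connected U \<and> (\<forall>z\<in>U. poly (cpoly A) z \<noteq> 0) \<and>
     (\<exists>F. (\<forall>z\<in>U. (F has_field_derivative poly (cpoly B) z / poly (cpoly A) z) (at z)) \<and>
          (\<forall>z\<in>U. W z = exp (F z)))"

text \<open>The weight agrees on the open interval \<open>I\<close>, up to a non-zero constant, with a boundary
  value \<open>w\<^sub>+\<close> taken from the upper half-plane. The domain \<open>U\<close> of the branch is only required to
  be a one-sided neighbourhood of \<open>I\<close>, since \<open>A\<close> may vanish in the upper half-plane.\<close>

definition upper_boundary_value_on ::
    "real poly \<Rightarrow> real poly \<Rightarrow> real set \<Rightarrow> (real \<Rightarrow> real) \<Rightarrow> bool" where
  "upper_boundary_value_on A B I w \<longleftrightarrow>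
     (\<exists>U W c. semiclassical_branch A B U W \<and> U \<subseteq> {z. Im z > 0} \<and> c \<noteq> 0 \<and>
        (\<forall>x\<in>I. (\<forall>\<^sub>F z in at (complex_of_real x) within {z. Im z > 0}. z \<in> U) \<and>
               ((\<lambda>z. c * W z) \<longlongrightarrow> complex_of_real (w x))
                 (at (complex_of_real x) within {z. Im z > 0})))"

text \<open>A finite union of intervals is encoded by the set \<open>J\<close> of its pairs of (possibly infinite)
  endpoints; the support contains the finite endpoints. Values of the weight at endpoints are
  irrelevant, since they only affect a null set.\<close>

definition support_of :: "(ereal \<times> ereal) set \<Rightarrow> real set" where
  "support_of J = (\<Union>(a, b)\<in>J. {x. a \<le> ereal x \<and> ereal x \<le> b})"

definition semiclassical_weight ::
    "real poly \<Rightarrow> real poly \<Rightarrow> (ereal \<times> ereal) set \<Rightarrow> (real \<Rightarrow> real) \<Rightarrow> bool" where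
  "semiclassical_weight A B J w \<longleftrightarrow>
     lead_coeff A = 1 \<and>
     finite J \<and>
     disjoint_family_on (\<lambda>(a, b). einterval a b) J \<and>
     (\<forall>(a, b)\<in>J. a < b \<and>
        (\<forall>e\<in>{a, b}. \<bar>e\<bar> = \<infinity> \<or> poly A (real_of_ereal e) = 0) \<and>
        (\<forall>x\<in>einterval a b. poly A x \<noteq> 0) \<and>
        (\<forall>x\<in>einterval a b. w x > 0) \<and>
        upper_boundary_value_on A B (einterval a b) w) \<and>
     (\<forall>m::nat. set_integrable lborel (support_of J) (\<lambda>x. \<bar>x\<bar> ^ m * \<bar>w x\<bar>))"

definition semiclassical_class :: "real poly \<Rightarrow> real poly \<Rightarrow> int" where
  "semiclassical_class A B = max (int (degree A) - 2) (int (degree B) - 1)"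

definition cauchy_transform ::
    "real set \<Rightarrow> (real \<Rightarrow> real) \<Rightarrow> (complex \<Rightarrow> complex) \<Rightarrow> complex \<Rightarrow> complex" where
  "cauchy_transform \<Delta> w f z =
     (LINT t:\<Delta>|lborel. f (of_real t) * of_real (w t) / (of_real t - z))"

text \<open>Meaningful for \<open>z\<close> outside the support \<open>\<Delta>\<close> only.\<close>

definition electrostatic_partner ::
    "real poly \<Rightarrow> real poly \<Rightarrow> real set \<Rightarrow> (real \<Rightarrow> real) \<Rightarrow> complex poly \<Rightarrow> complex \<Rightarrow> complex" where
  "electrostatic_partner A B \<Delta> w P z =
     (let K = cauchy_transform \<Delta> w (poly P);
          a = poly (cpoly A) z; b = poly (cpoly B) z
      in det (vector
           [vector [poly P z, K z],
            vector [a * poly (pderiv P) z, a * deriv K z - b * K z]] :: complex^2^2))"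

text \<open>The branch \<open>W\<close> of the weight is a parameter.\<close>

definition second_kind ::
    "real set \<Rightarrow> (real \<Rightarrow> real) \<Rightarrow> (complex \<Rightarrow> complex) \<Rightarrow> complex poly \<Rightarrow> complex \<Rightarrow> complex" where
  "second_kind \<Delta> w W P z = cauchy_transform \<Delta> w (poly P) z / W z"

definition wronskian3 ::
    "(complex \<Rightarrow> complex) \<Rightarrow> (complex \<Rightarrow> complex) \<Rightarrow> (complex \<Rightarrow> complex) \<Rightarrow> complex \<Rightarrow> complex" where
  "wronskian3 f g h z =
     det (vector
       [vector [f z, g z, h z],
        vector [deriv f z, deriv g z, deriv h z],
        vector [(deriv ^^ 2) f z, (deriv ^^ 2) g z, (deriv ^^ 2) h z]] :: complex^3^3)"

text \<open>\<open>Wrons[P, q\<^sub>1, q\<^sub>2] \<equiv> 0\<close> fails: some branches of \<open>q\<^sub>1, q\<^sub>2\<close> have a non-zero Wronskian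
  at some point off the supports. Changing branches multiplies the Wronskian by a non-zero
  constant.\<close>

definition wronskian_not_identically_zero ::
    "(nat \<Rightarrow> real poly) \<Rightarrow> (nat \<Rightarrow> real poly) \<Rightarrow> (nat \<Rightarrow> real set) \<Rightarrow> (nat \<Rightarrow> real \<Rightarrow> real) \<Rightarrow>
     complex poly \<Rightarrow> bool" where
  "wronskian_not_identically_zero A B \<Delta> w P \<longleftrightarrow>
     (\<exists>U W. (\<forall>i\<in>{1, 2}. semiclassical_branch (A i) (B i) U (W i) \<and>
                          U \<inter> complex_of_real ` \<Delta> i = {}) \<and>
        (\<exists>z\<in>U. wronskian3 (poly P)
                 (second_kind (\<Delta> 1) (w 1) (W 1) P)
                 (second_kind (\<Delta> 2) (w 2) (W 2) P) z \<noteq> 0))"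

end

theory Submission
  imports Defs "HOL-Complex_Analysis.Cauchy_Integral_Theorem"
    "HOL-Computational_Algebra.Fundamental_Theorem_Algebra"
begin

text \<open>
  Throughout, \<open>\<CC>[p](z)\<close> is the Cauchy transform of \<open>p\<close> times the weight, and two functions on the
  complement of the support are regarded as equivalent if they differ by a polynomial.

  The Cauchy transform is linear over polynomials modulo this equivalence:
  \<open>p \<CC>[q] \<equiv> \<CC>[p q]\<close>, because \<open>(p(z) - p(t)) / (t - z)\<close> is a polynomial
  (\<open>poly_times_cauchy\<close>).  The weight enters only through Pearson's equation
  \<open>(A w)' = (A' + B) w\<close>.  Integrating the derivative of \<open>A p w / (t - z)\<close> over the support, where the
  boundary terms vanish, turns it into
  \<open>A \<CC>[p]' - B \<CC>[p] \<equiv> \<CC>[A p']\<close> (\<open>Cauchy_transform_first_order\<close>).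

  Put \<open>K = \<CC>[P]\<close>, \<open>F = A P'\<close> and \<open>L = A K' - B K\<close>, so that \<open>L \<equiv> \<CC>[F]\<close>.  The electrostatic partner is
  \<open>S = P L - F K \<equiv> \<CC>[P F - F P] = 0\<close>, hence a polynomial.  The linear equation of second order
  solved by \<open>P\<close> and \<open>q = K / w\<close> has the coefficients \<open>A S\<close>, \<open>A' S - A S' + B S\<close> and
  \<open>A\<^sup>2 w (P' q'' - P'' q') = P' (A L' - B L) - F' L\<close>.  Applying the first-order relation once more,
  to \<open>F\<close>, shows that the last one is equivalent to \<open>\<CC>[P' A F' - F' F] = 0\<close>, so it is a polynomial too
  (\<open>electrostatic_ode\<close>).  No analytic continuation across the support is involved, and it does not
  matter where the zeros of \<open>P\<close> are.

  The degree of \<open>S\<close> comes from its growth along the imaginary axis: orthogonality makes \<open>K(z)\<close> decay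
  like \<open>z\<close> to the power \<open>-n-1\<close> (\<open>degree_electrostatic_partner\<close>).  The degree of the last coefficient is
  then read off from the differential equation itself (\<open>degree_ode_coefficient\<close>).

  The analytic input is Pearson's equation on each open interval, extracted from the boundary values
  of the branch (\<open>has_real_derivative_of_upper_boundary_value\<close>), and the vanishing of the boundary
  terms, which follows from the finiteness of the moments and the zeros of \<open>A\<close> at the finite
  endpoints (\<open>tendsto_0_endpoint\<close>).
\<close>

section \<open>Growth of complex polynomials\<close>

lemma norm_poly_le_power:
  fixes p :: "complex poly"
  assumes "degree p \<le> k"
  obtains c where "c \<ge> 0" "\<And>z. norm z \<ge> 1 \<Longrightarrow> norm (poly p z) \<le> c * norm z ^ k"
proof
  show "(\<Sum>i\<le>degree p. norm (coeff p i)) \<ge> 0" by (simp add: sum_nonneg)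
  fix z :: complex assume z: "norm z \<ge> 1"
  have "norm (poly p z) \<le> (\<Sum>i\<le>degree p. norm (coeff p i) * norm z ^ i)"
    unfolding poly_altdef by (rule sum_norm_le) (simp add: norm_mult norm_power)
  also have "\<dots> \<le> (\<Sum>i\<le>degree p. norm (coeff p i) * norm z ^ k)"
    using z assms by (intro sum_mono mult_left_mono power_increasing) auto
  finally show "norm (poly p z) \<le> (\<Sum>i\<le>degree p. norm (coeff p i)) * norm z ^ k"
    by (simp add: sum_distrib_right)
qed

text \<open>Dividing by the variable, after removal of the constant term, lowers the exponent of the bound by
  one; a polynomial bounded on an unbounded set is constant.\<close>
lemma degree_le_of_norm_poly_le_power:
  fixes p :: "complex poly"
  assumes unbounded: "\<And>r. \<exists>z\<in>Z. norm z \<ge> r" and ge1: "\<And>z. z \<in> Z \<Longrightarrow> norm z \<ge> 1"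
    and bound: "\<And>z. z \<in> Z \<Longrightarrow> norm (poly p z) \<le> c * norm z ^ k"
  shows "degree p \<le> k"
  using bound
proof (induction k arbitrary: p c)
  case 0
  obtain a q where p: "p = pCons a q" by (cases p)
  have "q = 0"
  proof (rule ccontr)
    assume "q \<noteq> 0"
    from poly_infinity[OF this, of "c + 1" a] obtain r
      where r: "\<And>z. r \<le> norm z \<Longrightarrow> c + 1 \<le> norm (poly (pCons a q) z)" by blast
    obtain z where "z \<in> Z" "norm z \<ge> r" using unbounded by blast
    with r[of z] 0[of z] p show False by simp
  qed
  with p show ?case by simp
next
  case (Suc k)
  obtain a q where p: "p = pCons a q" by (cases p)
  have "norm (poly q z) \<le> (c + norm a) * norm z ^ k" if z: "z \<in> Z" for z
  proof -
    have 1: "norm z \<ge> 1" using ge1[OF z] .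
    have "norm z * norm (poly q z) = norm (poly p z - a)" by (simp add: p norm_mult)
    also have "\<dots> \<le> c * norm z ^ Suc k + norm a * norm z ^ Suc k"
      using norm_triangle_ineq4[of "poly p z" a] Suc.prems[OF z]
        mult_left_mono[OF one_le_power[OF 1, of "Suc k"], of "norm a"] by simp
    also have "\<dots> = norm z * ((c + norm a) * norm z ^ k)" by (simp add: algebra_simps)
    finally show ?thesis using 1 by (subst (asm) mult_le_cancel_left_pos) auto
  qed
  from Suc.IH[OF this] have "degree q \<le> k" by blast
  then show ?case by (simp add: p)
qed

lemma poly_eq_0_off_reals:
  fixes p :: "complex poly"
  assumes "\<And>z. Im z \<noteq> 0 \<Longrightarrow> poly p z = 0"
  shows "p = 0"
proof (rule ccontr)
  assume "p \<noteq> 0"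
  then have "finite {z. poly p z = 0}" by (rule poly_roots_finite)
  moreover have "range (\<lambda>k::nat. Complex 0 (real (Suc k))) \<subseteq> {z. poly p z = 0}"
    using assms by auto
  ultimately have "finite (range (\<lambda>k::nat. Complex 0 (real (Suc k))))"
    by (rule rev_finite_subset)
  then have "finite (UNIV :: nat set)" by (rule finite_imageD) (auto simp: inj_on_def)
  then show False by simp
qed

section \<open>Cauchy transforms of measures with finite moments\<close>

text \<open>The algebra below needs of the weight only the measure \<open>w(t) dt\<close> on its support.\<close>
locale moment_measure =
  fixes \<mu> :: "real measure" and \<Delta> :: "real set"
  assumes sets_measure: "sets \<mu> = sets borel"
    and moments: "\<And>m. integrable \<mu> (\<lambda>t. \<bar>t\<bar> ^ m)"
    and closed_support: "closed \<Delta>"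
    and AE_support: "AE t in \<mu>. t \<in> \<Delta>"
begin

lemmas [measurable_cong] = sets_measure

definition \<Omega> :: "complex set" where "\<Omega> = - complex_of_real ` \<Delta>"

definition \<CC> :: "complex poly \<Rightarrow> complex \<Rightarrow> complex" where
  "\<CC> p z = (LINT t|\<mu>. poly p (of_real t) / (of_real t - z))"

text \<open>The derivative of \<open>\<CC> p\<close>, see \<open>has_field_derivative_cauchy\<close>.\<close>
definition \<CC>' :: "complex poly \<Rightarrow> complex \<Rightarrow> complex" where
  "\<CC>' p z = (LINT t|\<mu>. poly p (of_real t) / (of_real t - z)\<^sup>2)"

lemma open_Omega: "open \<Omega>"
  unfolding \<Omega>_def using closed_support by (intro open_Compl closed_injective_linear_image) (auto simp: inj_def bounded_linear.linear bounded_linear_of_real)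

lemma nonreal_in_Omega: "Im z \<noteq> 0 \<Longrightarrow> z \<in> \<Omega>"
  by (auto simp: \<Omega>_def)

text \<open>A bound for the Cauchy kernel that is uniform in a neighbourhood of \<open>z\<close>.\<close>
lemma Omega_gap:
  assumes "z \<in> \<Omega>"
  obtains d where "d > 0" "\<And>u t. norm (u - z) < d \<Longrightarrow> t \<in> \<Delta> \<Longrightarrow> d \<le> norm (of_real t - u)"
proof -
  obtain e where e: "e > 0" "ball z e \<subseteq> \<Omega>"
    using open_Omega assms by (metis open_contains_ball)
  show thesis
  proof (rule that[of "e / 2"])
    fix u :: complex and t assume u: "norm (u - z) < e / 2" and t: "t \<in> \<Delta>"
    have "of_real t \<notin> ball z e" using e t by (auto simp: \<Omega>_def)
    then have "e \<le> norm (of_real t - z)" by (simp add: dist_norm norm_minus_commute)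
    also have "\<dots> \<le> norm (of_real t - u) + norm (u - z)"
      using norm_triangle_ineq[of "of_real t - u" "u - z"] by simp
    finally show "e / 2 \<le> norm (of_real t - u)" using u by linarith
  qed (use e in simp)
qed

lemma integrable_poly: "integrable \<mu> (\<lambda>t. poly p (complex_of_real t))"
proof -
  have "integrable \<mu> (\<lambda>t. coeff p i * complex_of_real t ^ i)" for i
  proof (rule integrable_mult_right, rule Bochner_Integration.integrable_bound[OF moments[of i]])
    show "(\<lambda>t. complex_of_real t ^ i) \<in> borel_measurable \<mu>" by measurable
  qed (auto simp: norm_power)
  then show ?thesis unfolding poly_altdef by (intro Bochner_Integration.integrable_sum)
qed

lemma measurable_poly [measurable]: "(\<lambda>t. poly p (complex_of_real t)) \<in> borel_measurable \<mu>"
  using integrable_poly by (rule borel_measurable_integrable)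

lemma integrable_poly_div:
  assumes "z \<in> \<Omega>"
  shows "integrable \<mu> (\<lambda>t. poly p (of_real t) / (of_real t - z) ^ k)"
proof -
  obtain d where d: "d > 0" "\<And>u t. norm (u - z) < d \<Longrightarrow> t \<in> \<Delta> \<Longrightarrow> d \<le> norm (of_real t - u)"
    using Omega_gap[OF assms] by blast
  show ?thesis
  proof (rule Bochner_Integration.integrable_bound)
    show "integrable \<mu> (\<lambda>t. poly p (complex_of_real t) * of_real (1 / d ^ k))"
      by (intro integrable_mult_left integrable_poly)
    show "AE t in \<mu>. norm (poly p (of_real t) / (of_real t - z) ^ k)
        \<le> norm (poly p (complex_of_real t) * of_real (1 / d ^ k))"
      using AE_support
    proof eventually_elim
      case (elim t)
      have "d ^ k \<le> norm (of_real t - z) ^ k" using d(1) d(2)[of z t] elim by (intro power_mono) auto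
      then show ?case using d(1)
        by (simp add: norm_mult norm_divide norm_power frac_le)
    qed
  qed measurable
qed

lemmas integrable_cauchy = integrable_poly_div[where k = 1, simplified]
lemmas integrable_cauchy_deriv = integrable_poly_div[where k = 2]

lemma cauchy_add: "z \<in> \<Omega> \<Longrightarrow> \<CC> (p + q) z = \<CC> p z + \<CC> q z"
  unfolding \<CC>_def by (simp add: add_divide_distrib integrable_cauchy)

lemma cauchy_smult: "\<CC> (smult a p) z = a * \<CC> p z"
  unfolding \<CC>_def by (simp flip: times_divide_eq_right)

lemma cauchy_0 [simp]: "\<CC> 0 z = 0" by (simp add: \<CC>_def)

lemma cauchy_times_variable:
  assumes "z \<in> \<Omega>"
  shows "z * \<CC> p z = \<CC> (pCons 0 p) z - (LINT t|\<mu>. poly p (of_real t))"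
proof -
  have "\<CC> (pCons 0 p) z - z * \<CC> p z =
      (LINT t|\<mu>. poly (pCons 0 p) (of_real t) / (of_real t - z) - z * (poly p (of_real t) / (of_real t - z)))"
    unfolding \<CC>_def using assms by (simp add: integrable_cauchy[of _ "pCons 0 p", simplified] integrable_cauchy del: poly_pCons times_divide_eq_right)
  also have "\<dots> = (LINT t|\<mu>. poly p (of_real t))"
  proof (rule integral_cong_AE)
    show "AE t in \<mu>. poly (pCons 0 p) (of_real t) / (of_real t - z) - z * (poly p (of_real t) / (of_real t - z))
        = poly p (of_real t)"
      using AE_support
    proof eventually_elim
      case (elim t)
      then have "of_real t - z \<noteq> 0" using assms by (auto simp: \<Omega>_def)
      then show ?case by (simp add: divide_simps) (simp add: algebra_simps)
    qed
  qed measurable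
  finally show ?thesis by (simp add: algebra_simps)
qed

text \<open>The difference quotient differs from the formal derivative by
  \<open>(u - z) / ((t - z)\<^sup>2 (t - u))\<close> under the integral, and the kernel is bounded near \<open>z\<close>.\<close>
lemma has_field_derivative_cauchy:
  assumes "z \<in> \<Omega>"
  shows "(\<CC> p has_field_derivative \<CC>' p z) (at z)"
proof -
  obtain d where d: "d > 0" "\<And>u t. norm (u - z) < d \<Longrightarrow> t \<in> \<Delta> \<Longrightarrow> d \<le> norm (of_real t - u)"
    using Omega_gap[OF assms] by blast
  define M where "M = (LINT t|\<mu>. norm (poly p (complex_of_real t)))"
  have near: "u \<in> \<Omega>" if "norm (u - z) < d" for u
    using d(2)[OF that] d(1) by (force simp: \<Omega>_def)
  have bound: "norm ((\<CC> p u - \<CC> p z) / (u - z) - \<CC>' p z) \<le> M / d ^ 3 * norm (u - z)"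
    if u: "norm (u - z) < d" "u \<noteq> z" for u
  proof -
    have "(\<CC> p u - \<CC> p z) / (u - z) - \<CC>' p z
      = (LINT t|\<mu>. (poly p (of_real t) / (of_real t - u) - poly p (of_real t) / (of_real t - z)) / (u - z)
            - poly p (of_real t) / (of_real t - z)\<^sup>2)"
      unfolding \<CC>_def \<CC>'_def using assms near[OF u(1)]
      by (simp add: integrable_cauchy integrable_cauchy_deriv)
    also have "\<dots> = (LINT t|\<mu>. (u - z) * (poly p (of_real t) / ((of_real t - z)\<^sup>2 * (of_real t - u))))"
    proof (rule integral_cong_AE)
      show "AE t in \<mu>. (poly p (of_real t) / (of_real t - u) - poly p (of_real t) / (of_real t - z)) / (u - z)
            - poly p (of_real t) / (of_real t - z)\<^sup>2
          = (u - z) * (poly p (of_real t) / ((of_real t - z)\<^sup>2 * (of_real t - u)))"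
        using AE_support
      proof eventually_elim
        case (elim t)
        then have "of_real t - z \<noteq> 0" "of_real t - u \<noteq> 0"
          using assms near[OF u(1)] by (auto simp: \<Omega>_def)
        with u(2) show ?case by (simp add: divide_simps power2_eq_square) (simp add: algebra_simps)
      qed
    qed measurable
    also have "norm \<dots> \<le> (LINT t|\<mu>. norm (u - z) / d ^ 3 * norm (poly p (complex_of_real t)))"
    proof -
      have int: "integrable \<mu> (\<lambda>t. norm (u - z) / d ^ 3 * norm (poly p (complex_of_real t)))"
        by (intro integrable_mult_right integrable_norm integrable_poly)
      have ae: "AE t in \<mu>. norm ((u - z) * (poly p (of_real t) / ((of_real t - z)\<^sup>2 * (of_real t - u))))
          \<le> norm (u - z) / d ^ 3 * norm (poly p (complex_of_real t))"
        using AE_support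
      proof eventually_elim
        case (elim t)
        have "d ^ 2 * d \<le> norm (of_real t - z) ^ 2 * norm (of_real t - u)"
          using d(1) d(2)[of z t] d(2)[of u t] u elim by (intro mult_mono power_mono) auto
        then have "d ^ 3 \<le> norm (of_real t - z) ^ 2 * norm (of_real t - u)"
          by (simp add: power2_eq_square power3_eq_cube)
        then have "norm (u - z) * (norm (poly p (of_real t)) / (norm (of_real t - z) ^ 2 * norm (of_real t - u)))
          \<le> norm (u - z) * (norm (poly p (complex_of_real t)) / d ^ 3)"
          using d(1) by (intro mult_left_mono frac_le) auto
        then show ?case by (simp add: norm_mult norm_divide norm_power)
      qed
      have "integrable \<mu> (\<lambda>t. norm ((u - z) * (poly p (of_real t) / ((of_real t - z)\<^sup>2 * (of_real t - u)))))"
      proof (rule Bochner_Integration.integrable_bound[OF int])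
        show "AE t in \<mu>. norm (norm ((u - z) * (poly p (of_real t) / ((of_real t - z)\<^sup>2 * (of_real t - u)))))
          \<le> norm (norm (u - z) / d ^ 3 * norm (poly p (complex_of_real t)))"
          using ae by eventually_elim
            (metis real_norm_def abs_norm_cancel abs_ge_self order.trans)
      qed measurable
      with int ae show ?thesis by (intro order.trans[OF integral_norm_bound integral_mono_AE])
    qed
    also have "\<dots> = M / d ^ 3 * norm (u - z)" by (simp add: M_def)
    finally show ?thesis .
  qed
  have "((\<lambda>u. (\<CC> p u - \<CC> p z) / (u - z) - \<CC>' p z) \<longlongrightarrow> 0) (at z)"
  proof (rule Lim_null_comparison)
    show "\<forall>\<^sub>F u in at z. norm ((\<CC> p u - \<CC> p z) / (u - z) - \<CC>' p z) \<le> M / d ^ 3 * norm (u - z)"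
      unfolding eventually_at using d(1) bound by (auto simp: dist_norm)
    show "((\<lambda>u. M / d ^ 3 * norm (u - z)) \<longlongrightarrow> 0) (at z)" using d(1) by (auto intro!: tendsto_eq_intros)
  qed
  then show ?thesis unfolding has_field_derivative_iff by (simp add: LIM_zero_iff)
qed

text \<open>Multiplying by the variable changes the transform by a moment, that is, by a constant; the general
  multiplier follows by Horner's scheme.\<close>
lemma poly_times_cauchy:
  "\<exists>R. \<forall>z\<in>\<Omega>. poly p z * \<CC> q z = \<CC> (p * q) z + poly R z"
proof (induction p)
  case (pCons a p)
  then obtain R where R: "\<And>z. z \<in> \<Omega> \<Longrightarrow> poly p z * \<CC> q z = \<CC> (p * q) z + poly R z" by blast
  have "poly (pCons a p) z * \<CC> q z = \<CC> (pCons a p * q) z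
      + poly (pCons (- (LINT t|\<mu>. poly (p * q) (of_real t))) R) z" if z: "z \<in> \<Omega>" for z
  proof -
    have "poly (pCons a p) z * \<CC> q z = a * \<CC> q z + z * (poly p z * \<CC> q z)" by (simp add: algebra_simps)
    also have "\<dots> = \<CC> (smult a q) z + z * \<CC> (p * q) z + z * poly R z"
      by (simp add: R[OF z] cauchy_smult algebra_simps)
    also have "\<dots> = \<CC> (pCons a p * q) z + poly (pCons (- (LINT t|\<mu>. poly (p * q) (of_real t))) R) z"
      using z by (simp add: cauchy_times_variable cauchy_add)
    finally show ?thesis .
  qed
  then show ?case by blast
qed (auto intro!: exI[of _ 0])

text \<open>The constants produced by the successive multiplications by \<open>z\<close> are the moments that vanish by
  orthogonality.\<close>
lemma power_times_cauchy_of_orthogonal: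
  assumes orth: "\<And>j. j < n \<Longrightarrow> (LINT t|\<mu>. of_real t ^ j * poly p (of_real t)) = 0"
    and z: "z \<in> \<Omega>"
  shows "z ^ n * \<CC> p z = \<CC> (monom 1 n * p) z"
  using orth
proof (induction n)
  case (Suc n)
  have "z ^ Suc n * \<CC> p z = z * \<CC> (monom 1 n * p) z" using Suc by simp
  also have "\<dots> = \<CC> (monom 1 (Suc n) * p) z"
    using Suc.prems[of n] by (simp add: cauchy_times_variable[OF z] poly_monom monom_Suc)
  finally show ?case .
qed (simp add: \<CC>_def)

text \<open>The support is real but may be unbounded.  On the imaginary axis the distance to it is at least
  \<open>y\<close>, so this is where the decay of the transform is measured.\<close>
lemma norm_integral_imaginary_axis:
  assumes y: "y > 0"
  shows "norm (LINT t|\<mu>. poly p (of_real t) / (of_real t - Complex 0 y) ^ k)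
      \<le> (LINT t|\<mu>. norm (poly p (complex_of_real t))) / y ^ k"
proof -
  have "norm (LINT t|\<mu>. poly p (of_real t) / (of_real t - Complex 0 y) ^ k)
      \<le> (LINT t|\<mu>. norm (poly p (complex_of_real t)) / y ^ k)"
  proof (rule Bochner_Integration.integral_norm_bound_integral)
    show "integrable \<mu> (\<lambda>t. poly p (of_real t) / (of_real t - Complex 0 y) ^ k)"
      using y by (intro integrable_poly_div nonreal_in_Omega) auto
    fix t
    have "y \<le> norm (of_real t - Complex 0 y)"
      using abs_Im_le_cmod[of "of_real t - Complex 0 y"] y by simp
    then have "y ^ k \<le> norm (of_real t - Complex 0 y) ^ k" using y by (intro power_mono) auto
    then show "norm (poly p (of_real t) / (of_real t - Complex 0 y) ^ k)
        \<le> norm (poly p (complex_of_real t)) / y ^ k"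
      using y by (auto simp: norm_divide norm_power intro!: divide_left_mono mult_pos_pos
          intro: less_le_trans[of 0 "y^k"])
  qed (auto intro!: integrable_norm integrable_poly integrable_divide)
  then show ?thesis by simp
qed

end

section \<open>The differential equation for a Pearson measure\<close>

text \<open>The assumption is \<open>\<integral> (a f' + (a' + b) f) d\<mu> = 0\<close>, the weak form of Pearson's equation, tested
  against \<open>f(t) = p(t) / (t - z)\<close>.\<close>
locale pearson_measure = moment_measure +
  fixes a b :: "complex poly"
  assumes pearson: "\<And>p z. z \<in> \<Omega> \<Longrightarrow>
    (LINT t|\<mu>. poly (a * pderiv p + (pderiv a + b) * p) (of_real t) / (of_real t - z)
      - poly (a * p) (of_real t) / (of_real t - z)\<^sup>2) = 0"
begin

lemma pearson_cauchy:
  assumes "z \<in> \<Omega>"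
  shows "\<CC>' (a * p) z = \<CC> (a * pderiv p) z + \<CC> (pderiv a * p) z + \<CC> (b * p) z"
proof -
  have "\<CC> (a * pderiv p + (pderiv a + b) * p) z - \<CC>' (a * p) z = 0"
    using pearson[OF assms, of p] assms unfolding \<CC>_def \<CC>'_def
    by (simp only: Bochner_Integration.integral_diff[OF integrable_cauchy[OF assms] integrable_cauchy_deriv[OF assms]])
  then show ?thesis using assms by (simp add: cauchy_add distrib_right add.assoc)
qed

text \<open>The weak Pearson equation controls \<open>\<CC>' (a p)\<close>.  To pass from it to \<open>a \<CC>' p\<close>, the relation
  \<open>a \<CC> p \<equiv> \<CC> (a p)\<close> is differentiated.\<close>
lemma Cauchy_transform_first_order:
  "\<exists>R. \<forall>z\<in>\<Omega>. poly a z * \<CC>' p z - poly b z * \<CC> p z = \<CC> (a * pderiv p) z + poly R z"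
proof -
  obtain R1 R2 R3 where
    R1: "\<And>z. z \<in> \<Omega> \<Longrightarrow> poly a z * \<CC> p z = \<CC> (a * p) z + poly R1 z" and
    R2: "\<And>z. z \<in> \<Omega> \<Longrightarrow> poly (pderiv a) z * \<CC> p z = \<CC> (pderiv a * p) z + poly R2 z" and
    R3: "\<And>z. z \<in> \<Omega> \<Longrightarrow> poly b z * \<CC> p z = \<CC> (b * p) z + poly R3 z"
    using poly_times_cauchy[of a p] poly_times_cauchy[of "pderiv a" p] poly_times_cauchy[of b p] by metis
  have "poly a z * \<CC>' p z - poly b z * \<CC> p z = \<CC> (a * pderiv p) z + poly (pderiv R1 - R2 - R3) z"
    if z: "z \<in> \<Omega>" for z
  proof -
    have "((\<lambda>z. poly a z * \<CC> p z) has_field_derivative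
        poly (pderiv a) z * \<CC> p z + poly a z * \<CC>' p z) (at z)"
      using z by (auto intro!: derivative_eq_intros has_field_derivative_cauchy poly_DERIV)
    moreover have "((\<lambda>z. \<CC> (a * p) z + poly R1 z) has_field_derivative
        \<CC>' (a * p) z + poly (pderiv R1) z) (at z)"
      using z by (auto intro!: derivative_eq_intros has_field_derivative_cauchy poly_DERIV)
    then have "((\<lambda>z. poly a z * \<CC> p z) has_field_derivative
        \<CC>' (a * p) z + poly (pderiv R1) z) (at z)"
      by (rule has_field_derivative_transform_within_open[OF _ open_Omega z]) (simp add: R1)
    ultimately have "poly (pderiv a) z * \<CC> p z + poly a z * \<CC>' p z = \<CC>' (a * p) z + poly (pderiv R1) z"
      by (rule DERIV_unique)
    with pearson_cauchy[OF z, of p] R2[OF z] R3[OF z] show ?thesis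
      by (simp add: algebra_simps)
  qed
  then show ?thesis by blast
qed

text \<open>\<open>Q\<close> stands for \<open>a\<^sup>2 w (p' q'' - p'' q')\<close> with \<open>q = \<CC> p / w\<close>, written without \<open>w\<close>.  Once \<open>S\<close>
  and \<open>Q\<close> are known to be polynomials, the equation is an identity between \<open>p\<close>, \<open>\<CC> p\<close>, \<open>\<CC>' p\<close> and
  \<open>L'\<close>, in which \<open>L'\<close> cancels.\<close>
theorem electrostatic_ode:
  "\<exists>S Q. (\<forall>z\<in>\<Omega>. poly S z =
        poly p z * (poly a z * \<CC>' p z - poly b z * \<CC> p z) - poly (a * pderiv p) z * \<CC> p z) \<and>
     a * S * pderiv (pderiv p) + (pderiv a * S - a * pderiv S + b * S) * pderiv p + Q * p = 0"
proof -
  define F where "F = a * pderiv p"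
  define L where "L z = poly a z * \<CC>' p z - poly b z * \<CC> p z" for z
  obtain E where E: "\<And>z. z \<in> \<Omega> \<Longrightarrow> L z = \<CC> F z + poly E z"
    using Cauchy_transform_first_order[of p] unfolding F_def L_def by blast
  obtain E2 where E2: "\<And>z. z \<in> \<Omega> \<Longrightarrow> poly a z * \<CC>' F z - poly b z * \<CC> F z = \<CC> (a * pderiv F) z + poly E2 z"
    using Cauchy_transform_first_order[of F] by blast
  obtain R1 R2 R3 R4 where
    R1: "\<And>z. z \<in> \<Omega> \<Longrightarrow> poly p z * \<CC> F z = \<CC> (p * F) z + poly R1 z" and
    R2: "\<And>z. z \<in> \<Omega> \<Longrightarrow> poly F z * \<CC> p z = \<CC> (F * p) z + poly R2 z" and
    R3: "\<And>z. z \<in> \<Omega> \<Longrightarrow> poly (pderiv p) z * \<CC> (a * pderiv F) z = \<CC> (pderiv p * (a * pderiv F)) z + poly R3 z" and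
    R4: "\<And>z. z \<in> \<Omega> \<Longrightarrow> poly (pderiv F) z * \<CC> F z = \<CC> (pderiv F * F) z + poly R4 z"
    using poly_times_cauchy[of p F] poly_times_cauchy[of F p]
      poly_times_cauchy[of "pderiv p" "a * pderiv F"] poly_times_cauchy[of "pderiv F" F] by metis
  define S where "S = R1 - R2 + p * E"
  define Q where "Q = R3 - R4 + pderiv p * (E2 + a * pderiv E - b * E) - pderiv F * E"
  have S: "poly S z = poly p z * L z - poly F z * \<CC> p z" if "z \<in> \<Omega>" for z
    using E[OF that] R1[OF that] R2[OF that] by (simp add: S_def algebra_simps)
  have Q: "poly Q z = poly (pderiv p) z * (poly a z * (\<CC>' F z + poly (pderiv E) z) - poly b z * L z)
      - poly (pderiv F) z * L z" if z: "z \<in> \<Omega>" for z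
  proof -
    \<comment> \<open>This coincidence makes the two Cauchy transforms in \<open>Q\<close> cancel.\<close>
    have comm: "pderiv p * (a * pderiv F) = pderiv F * F" by (simp add: F_def ac_simps)
    have "poly a z * (\<CC>' F z + poly (pderiv E) z) - poly b z * L z
        = \<CC> (a * pderiv F) z + poly (E2 + a * pderiv E - b * E) z"
      using E2[OF z] E[OF z] by (simp add: algebra_simps)
    then show ?thesis
      using R3[OF z, unfolded comm] R4[OF z] E[OF z] by (simp add: Q_def algebra_simps)
  qed
  have dS: "poly (pderiv S) z = poly (pderiv p) z * L z + poly p z * (\<CC>' F z + poly (pderiv E) z)
      - poly (pderiv F) z * \<CC> p z - poly F z * \<CC>' p z" if z: "z \<in> \<Omega>" for z
  proof -
    have "((\<lambda>z. poly p z * (\<CC> F z + poly E z) - poly F z * \<CC> p z) has_field_derivative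
        poly (pderiv p) z * L z + poly p z * (\<CC>' F z + poly (pderiv E) z)
      - poly (pderiv F) z * \<CC> p z - poly F z * \<CC>' p z) (at z)"
      using z by (auto intro!: derivative_eq_intros has_field_derivative_cauchy poly_DERIV simp: E)
    then have "(poly S has_field_derivative poly (pderiv p) z * L z + poly p z * (\<CC>' F z + poly (pderiv E) z)
      - poly (pderiv F) z * \<CC> p z - poly F z * \<CC>' p z) (at z)"
      by (rule has_field_derivative_transform_within_open[OF _ open_Omega z]) (simp add: S E)
    then show ?thesis using poly_DERIV DERIV_unique by blast
  qed
  have "poly (a * S * pderiv (pderiv p) + (pderiv a * S - a * pderiv S + b * S) * pderiv p + Q * p) z = 0"
    if "Im z \<noteq> 0" for z
  proof -
    have z: "z \<in> \<Omega>" using nonreal_in_Omega[OF that] .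
    show ?thesis unfolding poly_add poly_mult poly_diff S[OF z] Q[OF z] dS[OF z]
      by (simp add: L_def F_def pderiv_mult algebra_simps)
  qed
  then have "a * S * pderiv (pderiv p) + (pderiv a * S - a * pderiv S + b * S) * pderiv p + Q * p = 0"
    by (rule poly_eq_0_off_reals)
  with S show ?thesis unfolding L_def F_def by blast
qed

end

context moment_measure
begin

text \<open>With \<open>q = z\<^sup>n p\<close> orthogonality gives \<open>z\<^sup>n \<CC> p = \<CC> q\<close>, which is of order \<open>1 / z\<close>.  Hence \<open>S\<close>
  times \<open>z\<close> to the power \<open>n + 1\<close> is a combination of \<open>\<CC> q\<close> and \<open>z \<CC>' q\<close>, both of order \<open>1 / z\<close>, with
  polynomial coefficients.  Bounding \<open>z p'\<close> rather than \<open>p'\<close> covers constant \<open>p\<close>.\<close>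
lemma degree_electrostatic_partner:
  assumes deg: "degree p \<le> N" "degree a \<le> m + 1" "degree b \<le> m"
    and orth: "\<And>j. j < n \<Longrightarrow> (LINT t|\<mu>. of_real t ^ j * poly p (of_real t)) = 0"
    and S: "\<And>z. z \<in> \<Omega> \<Longrightarrow> poly S z =
        poly p z * (poly a z * \<CC>' p z - poly b z * \<CC> p z) - poly (a * pderiv p) z * \<CC> p z"
  shows "degree (monom 1 (Suc n) * S) \<le> N + m"
proof -
  define q where "q = monom 1 n * p"
  have M: "z ^ n * \<CC> p z = \<CC> q z" if "z \<in> \<Omega>" for z
    unfolding q_def using power_times_cauchy_of_orthogonal[OF orth that] .
  have M': "z ^ Suc n * \<CC>' p z = z * \<CC>' q z - of_nat n * \<CC> q z" if z: "z \<in> \<Omega>" for z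
  proof -
    have "((\<lambda>z. z ^ n * \<CC> p z) has_field_derivative
        of_nat n * z ^ (n - 1) * \<CC> p z + z ^ n * \<CC>' p z) (at z)"
      using z by (auto intro!: derivative_eq_intros has_field_derivative_cauchy)
    then have "(\<CC> q has_field_derivative of_nat n * z ^ (n - 1) * \<CC> p z + z ^ n * \<CC>' p z) (at z)"
      by (rule has_field_derivative_transform_within_open[OF _ open_Omega z]) (simp add: M)
    then have "\<CC>' q z = of_nat n * z ^ (n - 1) * \<CC> p z + z ^ n * \<CC>' p z"
      using has_field_derivative_cauchy[OF z] DERIV_unique by blast
    then show ?thesis by (cases n) (simp_all add: M[OF z, symmetric] algebra_simps)
  qed
  have zS: "poly (monom 1 (Suc n) * S) z = poly a z * poly p z * (z * \<CC>' q z - of_nat n * \<CC> q z)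
      - z * poly b z * poly p z * \<CC> q z - poly a z * poly (pCons 0 (pderiv p)) z * \<CC> q z"
    if z: "z \<in> \<Omega>" for z
  proof -
    have "poly (monom 1 (Suc n) * S) z = poly a z * poly p z * (z ^ Suc n * \<CC>' p z)
      - z * poly b z * poly p z * (z ^ n * \<CC> p z) - poly a z * poly (pCons 0 (pderiv p)) z * (z ^ n * \<CC> p z)"
      unfolding poly_mult S[OF z] by (simp add: poly_monom algebra_simps)
    then show ?thesis unfolding M[OF z] M'[OF z] .
  qed
  have "degree (pCons 0 (pderiv p)) \<le> N"
    using deg(1) by (cases "pderiv p = 0") (auto simp: degree_pderiv degree_pCons_eq pderiv_eq_0_iff)
  then obtain cd where cd: "cd \<ge> 0" "\<And>z. norm z \<ge> 1 \<Longrightarrow> norm (poly (pCons 0 (pderiv p)) z) \<le> cd * norm z ^ N"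
    using norm_poly_le_power by blast
  obtain cp where cp: "cp \<ge> 0" "\<And>z. norm z \<ge> 1 \<Longrightarrow> norm (poly p z) \<le> cp * norm z ^ N"
    using norm_poly_le_power[OF deg(1)] by blast
  obtain ca where ca: "ca \<ge> 0" "\<And>z. norm z \<ge> 1 \<Longrightarrow> norm (poly a z) \<le> ca * norm z ^ (m + 1)"
    using norm_poly_le_power[OF deg(2)] by blast
  obtain cb where cb: "cb \<ge> 0" "\<And>z. norm z \<ge> 1 \<Longrightarrow> norm (poly b z) \<le> cb * norm z ^ m"
    using norm_poly_le_power[OF deg(3)] by blast
  define c where "c = (LINT t|\<mu>. norm (poly q (complex_of_real t)))"
  have c0: "c \<ge> 0" unfolding c_def by simp
  define Z where "Z = Complex 0 ` {1..}"
  have bound: "norm (poly (monom 1 (Suc n) * S) z)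
      \<le> (ca * cp * (c + of_nat n * c) + cb * cp * c + ca * cd * c) * norm z ^ (N + m)"
    if zZ: "z \<in> Z" for z
  proof -
    obtain y where z: "z = Complex 0 y" and y: "y \<ge> 1" using zZ by (auto simp: Z_def)
    have nz: "norm z = y" using y by (simp add: z cmod_def)
    have zO: "z \<in> \<Omega>" using y z by (intro nonreal_in_Omega) auto
    have C1: "norm (\<CC> q z) \<le> c / y"
      using norm_integral_imaginary_axis[of y q 1] y by (simp add: \<CC>_def c_def z)
    have C2: "norm (\<CC>' q z) \<le> c / y\<^sup>2"
      using norm_integral_imaginary_axis[of y q 2] y by (simp add: \<CC>'_def c_def z)
    have C12: "norm (z * \<CC>' q z - of_nat n * \<CC> q z) \<le> (c + of_nat n * c) / y"
    proof -
      have "norm (z * \<CC>' q z - of_nat n * \<CC> q z) \<le> norm z * norm (\<CC>' q z) + of_nat n * norm (\<CC> q z)"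
        by (metis norm_mult norm_of_nat norm_triangle_ineq4)
      also have "\<dots> \<le> y * (c / y\<^sup>2) + of_nat n * (c / y)"
        unfolding nz using y C1 C2 by (intro add_mono mult_left_mono) auto
      also have "\<dots> = (c + of_nat n * c) / y" using y by (simp add: field_simps power2_eq_square)
      finally show ?thesis .
    qed
    note pa = ca(2)[of z, unfolded nz, OF y] and pb = cb(2)[of z, unfolded nz, OF y]
      and pp = cp(2)[of z, unfolded nz, OF y] and pd = cd(2)[of z, unfolded nz, OF y]
    have "norm (poly a z * poly p z * (z * \<CC>' q z - of_nat n * \<CC> q z))
        \<le> (ca * y ^ (m + 1)) * (cp * y ^ N) * ((c + of_nat n * c) / y)"
      unfolding norm_mult using y ca(1) cp(1) pa pp C12[unfolded norm_mult] by (intro mult_mono) auto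
    also have "\<dots> = ca * cp * (c + of_nat n * c) * y ^ (N + m)"
      using y by (simp add: power_add)
    finally have 1: "norm (poly a z * poly p z * (z * \<CC>' q z - of_nat n * \<CC> q z))
        \<le> ca * cp * (c + of_nat n * c) * y ^ (N + m)" .
    have "norm (z * poly b z * poly p z * \<CC> q z) \<le> y * (cb * y ^ m) * (cp * y ^ N) * (c / y)"
      unfolding norm_mult nz using y cb(1) cp(1) pb pp C1 by (intro mult_mono) auto
    also have "\<dots> = cb * cp * c * y ^ (N + m)"
      using y by (simp add: power_add)
    finally have 2: "norm (z * poly b z * poly p z * \<CC> q z) \<le> cb * cp * c * y ^ (N + m)" .
    have "norm (poly a z * poly (pCons 0 (pderiv p)) z * \<CC> q z) \<le> (ca * y ^ (m + 1)) * (cd * y ^ N) * (c / y)"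
      unfolding norm_mult using y ca(1) cd(1) pa pd[unfolded norm_mult] C1
      by (intro mult_mono) auto
    also have "\<dots> = ca * cd * c * y ^ (N + m)"
      using y by (simp add: power_add)
    finally have 3: "norm (poly a z * poly (pCons 0 (pderiv p)) z * \<CC> q z) \<le> ca * cd * c * y ^ (N + m)" .
    have tri: "norm (u - v - w) \<le> norm u + norm v + norm w" for u v w :: complex
      by (smt (verit) norm_triangle_ineq4)
    show ?thesis
      unfolding zS[OF zO] nz distrib_right by (intro order.trans[OF tri] add_mono order.refl 1 2 3)
  qed
  show ?thesis
  proof (rule degree_le_of_norm_poly_le_power[OF _ _ bound])
    show "\<exists>z\<in>Z. r \<le> norm z" for r
      by (rule bexI[of _ "Complex 0 (max 1 r)"]) (auto simp: Z_def cmod_def)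
  qed (auto simp: Z_def cmod_def)
qed

end

text \<open>Every other term of the equation has degree at most \<open>s + \<sigma> + degree p\<close>.  Derivatives lower the
  degree only when they are non-zero; the zero cases are separated.\<close>
lemma degree_ode_coefficient:
  fixes a b p S Q :: "complex poly"
  assumes ode: "a * S * pderiv (pderiv p) + (pderiv a * S - a * pderiv S + b * S) * pderiv p + Q * p = 0"
    and p: "p \<noteq> 0" and deg: "int (degree a) \<le> \<sigma> + 2" "int (degree b) \<le> \<sigma> + 1"
    and s: "int (degree S) \<le> s" "0 \<le> s + \<sigma>"
  shows "int (degree Q) \<le> s + \<sigma>"
proof (cases "Q = 0 \<or> degree p = 0")
  case True
  then show ?thesis
  proof
    assume "degree p = 0"
    then have "pderiv p = 0" by (simp add: pderiv_eq_0_iff)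
    with ode p have "Q = 0" by simp
    then show ?thesis using s by simp
  qed (use s in simp)
next
  case False
  then have Q: "Q \<noteq> 0" and N: "degree p \<ge> 1" by auto
  have deg_mult: "int (degree (f * g)) \<le> int (degree f) + int (degree g)" for f g :: "complex poly"
    using degree_mult_le[of f g] by linarith
  let ?k = "nat (s + \<sigma> + int (degree p))"
  have "Q * p = - (a * S * pderiv (pderiv p)) - pderiv a * S * pderiv p + a * pderiv S * pderiv p - b * S * pderiv p"
    using ode by (simp add: algebra_simps add_eq_0_iff)
  moreover have "degree (- (a * S * pderiv (pderiv p)) - pderiv a * S * pderiv p + a * pderiv S * pderiv p - b * S * pderiv p) \<le> ?k"
  proof (intro degree_diff_le degree_add_le)
    have d2: "degree (pderiv (pderiv p)) = degree p - 2" by (simp add: degree_pderiv)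
    show "degree (- (a * S * pderiv (pderiv p))) \<le> ?k"
    proof (cases "pderiv (pderiv p) = 0")
      case False
      then have "degree p \<ge> 2" by (auto simp: pderiv_eq_0_iff degree_pderiv)
      with d2 have "int (degree (pderiv (pderiv p))) = int (degree p) - 2" by simp
      with deg_mult[of "a * S" "pderiv (pderiv p)"] deg_mult[of a S] deg s show ?thesis
        unfolding degree_minus by linarith
    qed simp
    have d1: "int (degree (pderiv p)) = int (degree p) - 1" using N by (simp add: degree_pderiv)
    show "degree (pderiv a * S * pderiv p) \<le> ?k"
    proof (cases "pderiv a = 0")
      case False
      then have "int (degree (pderiv a)) = int (degree a) - 1" by (simp add: pderiv_eq_0_iff degree_pderiv)
      with deg_mult[of "pderiv a * S" "pderiv p"] deg_mult[of "pderiv a" S] deg s d1 show ?thesis by linarith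
    qed simp
    show "degree (a * pderiv S * pderiv p) \<le> ?k"
    proof (cases "pderiv S = 0")
      case False
      then have "int (degree (pderiv S)) = int (degree S) - 1" by (simp add: pderiv_eq_0_iff degree_pderiv)
      with deg_mult[of "a * pderiv S" "pderiv p"] deg_mult[of a "pderiv S"] deg s d1 show ?thesis by linarith
    qed simp
    show "degree (b * S * pderiv p) \<le> ?k"
      using deg_mult[of "b * S" "pderiv p"] deg_mult[of b S] deg s d1 by linarith
  qed
  ultimately have "degree (Q * p) \<le> ?k" by simp
  then show ?thesis using Q p s by (simp add: degree_mult_eq)
qed

section \<open>Pearson's equation for a semiclassical weight\<close>

lemma poly_cpoly_of_real [simp]: "poly (cpoly p) (of_real x) = of_real (poly p x)"
  by (induction p) (auto simp: map_poly_pCons)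

text \<open>The branch is only given above the real axis.  Near a point of the interval \<open>B / A\<close> is holomorphic
  on a full disc and has a primitive \<open>G\<close> there, which differs from the exponent \<open>F\<close> of the branch by a
  constant on the upper half disc.  Hence the boundary values are those of \<open>exp G\<close> up to a constant
  factor, and \<open>exp G\<close> is differentiable across the axis.\<close>
lemma has_real_derivative_of_upper_boundary_value:
  assumes bv: "upper_boundary_value_on A B I w" and I: "open I" "x \<in> I" and A0: "poly A x \<noteq> 0"
  shows "(w has_real_derivative poly B x / poly A x * w x) (at x)"
proof -
  obtain U W c F where
    F: "\<And>z. z \<in> U \<Longrightarrow> (F has_field_derivative poly (cpoly B) z / poly (cpoly A) z) (at z)" and
    W: "\<And>z. z \<in> U \<Longrightarrow> W z = exp (F z)" and
    U: "\<And>y. y \<in> I \<Longrightarrow> \<forall>\<^sub>F z in at (complex_of_real y) within {z. Im z > 0}. z \<in> U" and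
    lim: "\<And>y. y \<in> I \<Longrightarrow> ((\<lambda>z. c * W z) \<longlongrightarrow> complex_of_real (w y))
            (at (complex_of_real y) within {z. Im z > 0})"
    using bv unfolding upper_boundary_value_on_def semiclassical_branch_def by metis
  obtain e1 where e1: "e1 > 0" "\<And>z. Im z > 0 \<Longrightarrow> dist z (of_real x) < e1 \<Longrightarrow> z \<in> U"
    using U[OF I(2)] unfolding eventually_at by (force simp: dist_commute)
  have "open {z. poly (cpoly A) z \<noteq> 0}"
    by (intro open_Collect_neq continuous_intros)
  moreover have "complex_of_real x \<in> {z. poly (cpoly A) z \<noteq> 0}" using A0 by simp
  ultimately obtain e2 where e2: "e2 > 0" "ball (complex_of_real x) e2 \<subseteq> {z. poly (cpoly A) z \<noteq> 0}"
    by (meson open_contains_ball)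
  obtain e3 where e3: "e3 > 0" "ball x e3 \<subseteq> I" using I by (meson open_contains_ball)
  define r where "r = min e1 (min e2 e3)"
  define D where "D = ball (complex_of_real x) r"
  define f where "f z = poly (cpoly B) z / poly (cpoly A) z" for z
  have r: "r > 0" using e1 e2 e3 by (simp add: r_def)
  have "f holomorphic_on D"
    unfolding f_def using e2 by (intro holomorphic_intros) (auto simp: D_def r_def)
  then obtain G where G0: "\<And>z. z \<in> D \<Longrightarrow> (G has_field_derivative f z) (at z within D)"
    using holomorphic_convex_primitive'[of D f] unfolding D_def by blast
  then have G: "(G has_field_derivative f z) (at z)" if "z \<in> D" for z
    using G0[OF that] that at_within_open[of z D] by (simp add: D_def)
  define H where "H = D \<inter> {z. Im z > 0}"
  have HU: "H \<subseteq> U" using e1(2) by (auto simp: H_def D_def r_def dist_commute)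
  have "\<exists>k. \<forall>z\<in>H. F z - G z = k"
  proof (rule has_field_derivative_zero_constant)
    show "convex H" unfolding H_def D_def by (intro convex_Int convex_ball convex_halfspace_Im_gt)
    show "((\<lambda>z. F z - G z) has_field_derivative 0) (at z within H)" if z: "z \<in> H" for z
    proof -
      have "(F has_field_derivative f z) (at z)" "(G has_field_derivative f z) (at z)"
        using F[of z] G[of z] z HU by (auto simp: f_def H_def)
      from DERIV_diff[OF this] show ?thesis
        by (simp add: has_field_derivative_at_within)
    qed
  qed
  then obtain k where k: "\<And>z. z \<in> H \<Longrightarrow> F z = G z + k" by (auto simp: algebra_simps)
  have w_eq: "complex_of_real (w y) = c * exp (G (of_real y) + k)" if y: "y \<in> ball x r" for y
  proof -
    have yD: "complex_of_real y \<in> D"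
      using y by (simp add: D_def dist_of_real)
    have path: "filterlim (Complex y) (at (complex_of_real y) within {z. Im z > 0}) (at_right 0)"
      unfolding filterlim_at
    proof
      show "\<forall>\<^sub>F t in at_right 0. Complex y t \<in> {z. Im z > 0} \<and> Complex y t \<noteq> of_real y"
        using eventually_at_right_less[of 0] by eventually_elim (auto simp: complex_eq_iff)
      have "((\<lambda>t. complex_of_real y + \<i> * of_real t) \<longlongrightarrow> of_real y + \<i> * of_real 0) (at_right 0)"
        by (intro tendsto_intros)
      then show "((\<lambda>t. Complex y t) \<longlongrightarrow> of_real y) (at_right 0)" by (simp add: Complex_eq)
    qed
    have "y \<in> I" using y e3 by (auto simp: r_def)
    from filterlim_compose[OF lim[OF this] path]
    have 1: "((\<lambda>t. c * W (Complex y t)) \<longlongrightarrow> complex_of_real (w y)) (at_right 0)" .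
    have Gcont: "isCont G (of_real y)" using G[OF yD] by (rule DERIV_isCont)
    then have "((\<lambda>z. c * exp (G z + k)) \<longlongrightarrow> c * exp (G (of_real y) + k))
        (at (complex_of_real y) within {z. Im z > 0})"
      by (intro tendsto_intros) (auto simp: isCont_def intro: tendsto_within_subset)
    from filterlim_compose[OF this path]
    have 2: "((\<lambda>t. c * exp (G (Complex y t) + k)) \<longlongrightarrow> c * exp (G (of_real y) + k)) (at_right 0)" .
    have "\<forall>\<^sub>F z in at (complex_of_real y) within {z. Im z > 0}. z \<in> D"
      unfolding eventually_at_topological using yD by (intro exI[of _ D]) (simp add: D_def)
    then have "\<forall>\<^sub>F z in at (complex_of_real y) within {z. Im z > 0}. z \<in> H"
      unfolding eventually_at_filter H_def by eventually_elim auto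
    then have "\<forall>\<^sub>F t in at_right 0. Complex y t \<in> H"
      using path by (rule eventually_compose_filterlim)
    then have "\<forall>\<^sub>F t in at_right 0. c * exp (G (Complex y t) + k) = c * W (Complex y t)"
      by eventually_elim (use k W HU in auto)
    from Lim_transform_eventually[OF 2 this] show ?thesis
      by (rule tendsto_unique[OF trivial_limit_at_right_real 1])
  qed
  have "((\<lambda>z. c * exp (G z + k)) has_field_derivative c * exp (G (of_real x) + k) * f (of_real x)) (at (of_real x))"
    using G[of "of_real x"] r by (auto intro!: derivative_eq_intros simp: D_def)
  then have "((\<lambda>z. c * exp (G z + k)) has_field_derivative of_real (w x) * f (of_real x)) (at (of_real x))"
    using w_eq[of x] r by simp
  then have "((\<lambda>y. c * exp (G (of_real y) + k)) has_vector_derivative of_real (w x) * f (of_real x)) (at x)"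
    by (rule has_vector_derivative_real_field)
  then have "((\<lambda>y. complex_of_real (w y)) has_vector_derivative of_real (w x) * f (of_real x)) (at x)"
    by (rule has_vector_derivative_transform_within_open[of _ _ _ "ball x r"]) (use r w_eq in auto)
  then have "((\<lambda>y. Re (complex_of_real (w y))) has_vector_derivative Re (of_real (w x) * f (of_real x))) (at x)"
    by (rule bounded_linear.has_vector_derivative[OF bounded_linear_Re])
  moreover have "f (of_real x) = of_real (poly B x / poly A x)" by (simp add: f_def)
  ultimately show ?thesis
    by (simp add: has_real_derivative_iff_has_vector_derivative mult.commute)
qed

text \<open>Dominated convergence in \<open>g(y) = g(c) + \<integral>\<^sub>c\<^sup>y g'\<close>.  Finite and infinite, left and right endpoints
  are treated at once.\<close>
lemma tendsto_endpoint_of_integrable_derivative: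
  fixes g g' :: "real \<Rightarrow> 'a::euclidean_space" and a b e :: ereal
  assumes "a < b"
    and deriv: "\<And>x. x \<in> einterval a b \<Longrightarrow> (g has_vector_derivative g' x) (at x)"
    and cont: "continuous_on (einterval a b) g'"
    and int: "set_integrable lborel (einterval a b) g'"
  obtains l where "((g \<circ> real_of_ereal) \<longlongrightarrow> l) (at e within {a<..<b})"
proof -
  obtain c where c: "c \<in> einterval a b" using einterval_nonempty[OF \<open>a < b\<close>] by blast
  \<comment> \<open>The oriented indicator function of the interval between \<open>c\<close> and \<open>x\<close>.\<close>
  define k :: "ereal \<Rightarrow> real \<Rightarrow> real" where
    "k x t = indicator (einterval c x) t - indicator (einterval x c) t" for x t
  define G where "G t = indicator (einterval a b) t *\<^sub>R g' t" for t
  have G: "integrable lborel G" using int unfolding set_integrable_def G_def .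
  have k_meas: "k x \<in> borel_measurable lborel" for x unfolding k_def by measurable
  have FTC: "g y = g c + (LINT t|lborel. k (ereal y) t *\<^sub>R G t)" if y: "y \<in> einterval a b" for y
  proof -
    have sub: "{min c y..max c y} \<subseteq> einterval a b"
    proof
      fix t assume "t \<in> {min c y..max c y}"
      then have t: "ereal (min c y) \<le> ereal t" "ereal t \<le> ereal (max c y)"
        unfolding ereal_less_eq by simp_all
      have "a < ereal (min c y)" "ereal (max c y) < b"
        using c y by (simp_all add: einterval_iff min_def max_def)
      with t show "t \<in> einterval a b"
        unfolding einterval_iff using less_le_trans le_less_trans by blast
    qed
    have "(LBINT t=ereal c..ereal y. g' t) = g y - g c"
    proof (rule interval_integral_FTC_finite)
      show "continuous_on {min c y..max c y} g'" using cont sub by (rule continuous_on_subset)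
      show "(g has_vector_derivative g' t) (at t within {min c y..max c y})"
        if "min c y \<le> t" "t \<le> max c y" for t
        using that sub by (auto intro: has_vector_derivative_at_within[OF deriv])
    qed
    moreover have "(LBINT t=ereal c..ereal y. g' t) = (LINT t|lborel. k (ereal y) t *\<^sub>R G t)"
    proof (cases "c \<le> y")
      case True
      have "k (ereal y) t *\<^sub>R G t = indicator {c<..<y} t *\<^sub>R g' t" for t
        using True sub by (auto simp: k_def G_def indicator_def)
      then show ?thesis using True
        by (simp add: interval_lebesgue_integral_def set_lebesgue_integral_def)
    next
      case False
      have "k (ereal y) t *\<^sub>R G t = - (indicator {y<..<c} t *\<^sub>R g' t)" for t
        using False sub by (auto simp: k_def G_def indicator_def)
      then show ?thesis using False
        by (simp add: interval_lebesgue_integral_def set_lebesgue_integral_def)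
    qed
    ultimately show ?thesis by simp
  qed
  have "((g \<circ> real_of_ereal) \<longlongrightarrow> g c + (LINT t|lborel. k e t *\<^sub>R G t)) (at e within {a<..<b})"
    unfolding tendsto_at_iff_sequentially
  proof (intro allI impI)
    fix X assume X: "\<forall>i. X i \<in> {a<..<b} - {e}" "X \<longlonglongrightarrow> e"
    have fin: "X i = ereal (real_of_ereal (X i))" for i
      using X(1)[rule_format, of i] by (cases "X i") auto
    have mem: "real_of_ereal (X i) \<in> einterval a b" for i
      using X(1)[rule_format, of i] fin[of i] by (simp add: einterval_iff)
    have "(\<lambda>i. LINT t|lborel. k (X i) t *\<^sub>R G t) \<longlonglongrightarrow> (LINT t|lborel. k e t *\<^sub>R G t)"
    proof (rule integral_dominated_convergence[where w = "\<lambda>t. norm (G t)"])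
      show "integrable lborel (\<lambda>t. norm (G t))" using G by (rule integrable_norm)
      show "AE t in lborel. (\<lambda>i. k (X i) t *\<^sub>R G t) \<longlonglongrightarrow> k e t *\<^sub>R G t"
        using AE_lborel_singleton[of "real_of_ereal e"]
      proof eventually_elim
        case (elim t)
        then have "ereal t < e \<or> e < ereal t" by (cases e) auto
        then have "\<forall>\<^sub>F i in sequentially. k (X i) t = k e t"
        proof
          assume "ereal t < e"
          from order_tendstoD(1)[OF X(2) this] show ?thesis
            by eventually_elim (use elim \<open>ereal t < e\<close> in \<open>auto simp: k_def indicator_def einterval_iff\<close>)
        next
          assume "e < ereal t"
          from order_tendstoD(2)[OF X(2) this] show ?thesis
            by eventually_elim (use elim \<open>e < ereal t\<close> in \<open>auto simp: k_def indicator_def einterval_iff\<close>)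
        qed
        then have "(\<lambda>i. k (X i) t) \<longlonglongrightarrow> k e t" by (rule tendsto_eventually)
        then show ?case by (intro tendsto_intros)
      qed
      show "AE t in lborel. norm (k (X i) t *\<^sub>R G t) \<le> norm (G t)" for i
        by (rule AE_I2) (auto simp: k_def indicator_def)
    qed (use G k_meas in \<open>auto intro!: borel_measurable_scaleR borel_measurable_integrable\<close>)
    then have "(\<lambda>i. g c + (LINT t|lborel. k (X i) t *\<^sub>R G t)) \<longlonglongrightarrow> g c + (LINT t|lborel. k e t *\<^sub>R G t)"
      by (intro tendsto_intros)
    moreover have "g \<circ> real_of_ereal \<circ> X = (\<lambda>i. g c + (LINT t|lborel. k (X i) t *\<^sub>R G t))"
    proof
      show "(g \<circ> real_of_ereal \<circ> X) i = g c + (LINT t|lborel. k (X i) t *\<^sub>R G t)" for i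
        using FTC[OF mem[of i]] fin[of i] by simp
    qed
    ultimately show "(g \<circ> real_of_ereal \<circ> X) \<longlonglongrightarrow> g c + (LINT t|lborel. k e t *\<^sub>R G t)"
      by simp
  qed
  then show thesis by (rule that)
qed

lemma at_left_eq_at_within_Ioo: "a < b \<Longrightarrow> at_left b = at b within {a<..<b}" for a b :: ereal
  by (rule at_within_nhd[of _ "{a<..}"]) auto

lemma at_right_eq_at_within_Ioo: "a < b \<Longrightarrow> at_right a = at a within {a<..<b}" for a b :: ereal
  by (rule at_within_nhd[of _ "{..<b}"]) auto

lemma at_endpoint_neq_bot:
  fixes a b :: ereal
  assumes "a < b" "e \<in> {a, b}"
  shows "at e within {a<..<b} \<noteq> bot"
proof -
  have "at_left b \<noteq> bot" using assms(1)
    by (cases b) (auto simp: at_left_ereal at_left_PInf filtermap_bot_iff)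
  moreover have "at_right a \<noteq> bot" using assms(1)
    by (cases a) (auto simp: at_right_ereal at_right_MInf filtermap_bot_iff)
  ultimately show ?thesis
    using assms by (auto simp flip: at_left_eq_at_within_Ioo at_right_eq_at_within_Ioo)
qed

lemma eventually_at_endpoint:
  fixes a b :: ereal
  assumes ab: "a < b" "e \<in> {a, b}" and P: "eventually P (at e within {a<..<b})"
  obtains a' b' where "a \<le> a'" "a' < b'" "b' \<le> b" "e \<in> {a', b'}"
    "\<And>x. a' < x \<Longrightarrow> x < b' \<Longrightarrow> P x"
proof (cases "e = b")
  case True
  with P ab have "eventually P (at_left b)" by (simp add: at_left_eq_at_within_Ioo)
  then obtain c where "c < b" "\<And>y. y > c \<Longrightarrow> y < b \<Longrightarrow> P y"
    using eventually_at_left[OF ab(1)] by blast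
  then show thesis using ab True by (intro that[of "max a c" b]) auto
next
  case False
  with ab have e: "e = a" by simp
  with P ab have "eventually P (at_right a)" by (simp add: at_right_eq_at_within_Ioo)
  then obtain c where "c > a" "\<And>y. y > a \<Longrightarrow> y < c \<Longrightarrow> P y"
    using eventually_at_right[OF ab(1)] by blast
  then show thesis using ab e by (intro that[of a "min b c"]) auto
qed

text \<open>If the limit of \<open>g\<close> were not zero, then \<open>\<phi>'\<close> would be dominated by a multiple of \<open>h\<close> near \<open>e\<close>,
  hence integrable, and \<open>\<phi>\<close> would have a finite limit at \<open>e\<close>.  For \<open>g = A p w / (t - z)\<close> the choice is
  \<open>\<phi> = t\<close> at an infinite endpoint, where \<open>g\<close> itself is integrable, and \<open>\<phi> = ln ((t - r)\<^sup>2)\<close> at a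
  finite endpoint \<open>r\<close>, where \<open>g / (t - r)\<close> is integrable because \<open>A\<close> vanishes at \<open>r\<close>.\<close>
lemma tendsto_0_endpoint:
  fixes g g' h :: "real \<Rightarrow> complex" and \<phi> \<phi>' :: "real \<Rightarrow> real" and a b e :: ereal
  assumes ab: "a < b" "e \<in> {a, b}"
    and deriv: "\<And>x. x \<in> einterval a b \<Longrightarrow> (g has_vector_derivative g' x) (at x)"
    and cont: "continuous_on (einterval a b) g'"
    and int: "set_integrable lborel (einterval a b) g'"
    and h: "set_integrable lborel (einterval a b) h"
    and \<phi>: "\<And>x. x \<in> einterval a b \<Longrightarrow> (\<phi> has_real_derivative \<phi>' x) (at x)"
    and cont_\<phi>': "continuous_on (einterval a b) \<phi>'"
    and bound: "\<And>x. x \<in> einterval a b \<Longrightarrow> norm (g x) * \<bar>\<phi>' x\<bar> \<le> norm (h x)"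
    and unbounded: "filterlim (\<phi> \<circ> real_of_ereal) at_infinity (at e within {a<..<b})"
  shows "((g \<circ> real_of_ereal) \<longlongrightarrow> 0) (at e within {a<..<b})"
proof -
  obtain l where l: "((g \<circ> real_of_ereal) \<longlongrightarrow> l) (at e within {a<..<b})"
    using tendsto_endpoint_of_integrable_derivative[OF ab(1) deriv cont int] .
  have "l = 0"
  proof (rule ccontr)
    assume "l \<noteq> 0"
    then have "\<forall>\<^sub>F x in at e within {a<..<b}. norm l / 2 < norm ((g \<circ> real_of_ereal) x)"
      by (intro order_tendstoD(1)[OF tendsto_norm[OF l]]) simp
    from eventually_at_endpoint[OF ab this] obtain a' b' where
      sub: "a \<le> a'" "a' < b'" "b' \<le> b" "e \<in> {a', b'}" and
      large: "\<And>x. a' < x \<Longrightarrow> x < b' \<Longrightarrow> norm l / 2 < norm ((g \<circ> real_of_ereal) x)" by blast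
    have sub': "einterval a' b' \<subseteq> einterval a b"
      using sub by (auto simp: einterval_iff intro: le_less_trans less_le_trans)
    have "set_integrable lborel (einterval a' b') \<phi>'"
      unfolding set_integrable_def
    proof (rule Bochner_Integration.integrable_bound)
      have "set_integrable lborel (einterval a' b') h"
        by (rule set_integrable_subset[OF h]) (use sub' in auto)
      then show "integrable lborel (\<lambda>x. (2 / norm l) *\<^sub>R indicator (einterval a' b') x *\<^sub>R h x)"
        unfolding set_integrable_def by (rule integrable_scaleR_right)
      show "(\<lambda>x. indicator (einterval a' b') x *\<^sub>R \<phi>' x) \<in> borel_measurable lborel"
        using borel_measurable_continuous_on_indicator[OF _ continuous_on_subset[OF cont_\<phi>' sub']]
        by simp
      have "\<bar>\<phi>' x\<bar> \<le> 2 / norm l * norm (h x)" if x: "x \<in> einterval a' b'" for x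
      proof -
        have "norm l / 2 * \<bar>\<phi>' x\<bar> \<le> norm (g x) * \<bar>\<phi>' x\<bar>"
          using large[of "ereal x"] x by (intro mult_right_mono) (auto simp: einterval_iff)
        also have "\<dots> \<le> norm (h x)" using bound[of x] x sub' by blast
        finally show ?thesis using \<open>l \<noteq> 0\<close> by (simp add: field_simps)
      qed
      then show "AE x in lborel. norm (indicator (einterval a' b') x *\<^sub>R \<phi>' x)
          \<le> norm ((2 / norm l) *\<^sub>R indicator (einterval a' b') x *\<^sub>R h x)"
        by (intro AE_I2) (auto simp: indicator_def)
    qed
    then obtain m where m: "((\<phi> \<circ> real_of_ereal) \<longlongrightarrow> m) (at e within {a'<..<b'})"
      using tendsto_endpoint_of_integrable_derivative[OF sub(2), of \<phi> \<phi>' e] \<phi> sub'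
        continuous_on_subset[OF cont_\<phi>' sub']
      by (metis has_real_derivative_iff_has_vector_derivative subsetD)
    have "at e within {a'<..<b'} \<le> at e within {a<..<b}"
      using sub by (intro at_le) (auto intro: le_less_trans less_le_trans)
    then have "filterlim (\<phi> \<circ> real_of_ereal) at_infinity (at e within {a'<..<b'})"
      using filterlim_mono[OF unbounded order.refl] by blast
    with m at_endpoint_neq_bot[OF sub(2,4)] show False
      using not_tendsto_and_filterlim_at_infinity by blast
  qed
  with l show ?thesis by simp
qed

lemma integral_derivative_eq_0:
  fixes g g' :: "real \<Rightarrow> complex" and a b :: ereal
  assumes ab: "a < b"
    and deriv: "\<And>x. x \<in> einterval a b \<Longrightarrow> (g has_vector_derivative g' x) (at x)"
    and cont: "continuous_on (einterval a b) g'"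
    and int: "set_integrable lborel (einterval a b) g'"
    and lim: "\<And>e. e \<in> {a, b} \<Longrightarrow> ((g \<circ> real_of_ereal) \<longlongrightarrow> 0) (at e within {a<..<b})"
  shows "(LINT x:einterval a b|lborel. g' x) = 0"
proof -
  have "(LBINT x=a..b. g' x) = 0 - 0"
  proof (rule interval_integral_FTC_integrable[OF ab _ _ int])
    show "(g has_vector_derivative g' x) (at x)" if "a < ereal x" "ereal x < b" for x
      using deriv that by (simp add: einterval_iff)
    show "isCont g' x" if "a < ereal x" "ereal x < b" for x
      using cont that by (simp add: continuous_on_eq_continuous_at einterval_iff)
    show "((g \<circ> real_of_ereal) \<longlongrightarrow> 0) (at_right a)" "((g \<circ> real_of_ereal) \<longlongrightarrow> 0) (at_left b)"
      using lim ab by (simp_all add: at_right_eq_at_within_Ioo at_left_eq_at_within_Ioo)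
  qed
  then show ?thesis using less_imp_le[OF ab] by (simp add: interval_lebesgue_integral_def)
qed

section \<open>The measure of a semiclassical weight\<close>

text \<open>The positivity of the weight is only known on the open intervals.  The restriction and the absolute
  value make the density non-negative everywhere; it agrees with \<open>w\<close> on the support up to the
  endpoints.\<close>
definition weight_density :: "(ereal \<times> ereal) set \<Rightarrow> (real \<Rightarrow> real) \<Rightarrow> real \<Rightarrow> real" where
  "weight_density J w t = indicator (\<Union>(a, b)\<in>J. einterval a b) t * \<bar>w t\<bar>"

definition weight_measure :: "(ereal \<times> ereal) set \<Rightarrow> (real \<Rightarrow> real) \<Rightarrow> real measure" where
  "weight_measure J w = density lborel (weight_density J w)"

locale semiclassical =
  fixes A B :: "real poly" and J :: "(ereal \<times> ereal) set" and w :: "real \<Rightarrow> real"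
  assumes weight: "semiclassical_weight A B J w"
begin

lemma finite_J: "finite J"
  using weight by (simp add: semiclassical_weight_def)

lemma interval_facts:
  assumes "(a, b) \<in> J"
  shows "a < b" "\<And>e. e \<in> {a, b} \<Longrightarrow> \<bar>e\<bar> = \<infinity> \<or> poly A (real_of_ereal e) = 0"
    "\<And>x. x \<in> einterval a b \<Longrightarrow> poly A x \<noteq> 0" "\<And>x. x \<in> einterval a b \<Longrightarrow> w x > 0"
    "upper_boundary_value_on A B (einterval a b) w"
proof -
  have facts: "a < b \<and> (\<forall>e\<in>{a, b}. \<bar>e\<bar> = \<infinity> \<or> poly A (real_of_ereal e) = 0) \<and>
      (\<forall>x\<in>einterval a b. poly A x \<noteq> 0) \<and> (\<forall>x\<in>einterval a b. w x > 0) \<and>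
      upper_boundary_value_on A B (einterval a b) w"
    using weight assms unfolding semiclassical_weight_def
    by (elim conjE) (drule (1) bspec, unfold prod.case, assumption)
  show "a < b" "upper_boundary_value_on A B (einterval a b) w" using facts by blast+
  show "\<bar>e\<bar> = \<infinity> \<or> poly A (real_of_ereal e) = 0" if "e \<in> {a, b}" for e
    using facts[THEN conjunct2, THEN conjunct1] that by (rule bspec)
  show "poly A x \<noteq> 0" "w x > 0" if "x \<in> einterval a b" for x
    using facts that by blast+
qed

lemma interior_subset_support: "(\<Union>(a, b)\<in>J. einterval a b) \<subseteq> support_of J"
  unfolding support_of_def einterval_def by fastforce

lemma closed_support_of: "closed (support_of J)"
proof -
  have "closed {x. a \<le> ereal x \<and> ereal x \<le> b}" for a b
    by (intro closed_Collect_conj closed_Collect_le continuous_intros continuous_on_ereal)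
  then show ?thesis unfolding support_of_def using finite_J by (intro closed_UN) auto
qed

lemma set_integrable_interior_moment:
  "set_integrable lborel (\<Union>(a, b)\<in>J. einterval a b) (\<lambda>t. \<bar>t\<bar> ^ m * \<bar>w t\<bar>)"
proof (rule set_integrable_subset)
  show "set_integrable lborel (support_of J) (\<lambda>t. \<bar>t\<bar> ^ m * \<bar>w t\<bar>)"
    using weight by (simp add: semiclassical_weight_def)
  show "(\<Union>(a, b)\<in>J. einterval a b) \<in> sets lborel" using finite_J by (auto intro!: sets.finite_UN)
qed (rule interior_subset_support)

lemma measurable_weight_density [measurable]: "weight_density J w \<in> borel_measurable borel"
  using borel_measurable_integrable[OF set_integrable_interior_moment[of 0, unfolded set_integrable_def]]
  by (simp add: weight_density_def[abs_def])

lemma weight_density_nonneg [simp]: "weight_density J w t \<ge> 0"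
  by (simp add: weight_density_def)

sublocale moment_measure "weight_measure J w" "support_of J"
proof
  show "sets (weight_measure J w) = sets borel" by (simp add: weight_measure_def)
  show "integrable (weight_measure J w) (\<lambda>t. \<bar>t\<bar> ^ m)" for m
  proof -
    have "integrable lborel (\<lambda>t. weight_density J w t *\<^sub>R \<bar>t\<bar> ^ m)"
      using set_integrable_interior_moment[of m]
      by (simp add: set_integrable_def weight_density_def ac_simps)
    then show ?thesis unfolding weight_measure_def by (subst integrable_density) auto
  qed
  show "closed (support_of J)" by (rule closed_support_of)
  have "t \<in> support_of J" if "weight_density J w t > 0" for t
  proof (rule ccontr)
    assume "t \<notin> support_of J"
    then have "t \<notin> (\<Union>(a, b)\<in>J. einterval a b)" using interior_subset_support by blast
    with that show False by (simp add: weight_density_def)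
  qed
  then show "AE t in weight_measure J w. t \<in> support_of J"
    unfolding weight_measure_def by (subst AE_density) auto
qed

text \<open>Only finitely many endpoints distinguish the two integrands.\<close>
lemma integral_weight_measure:
  fixes f :: "real \<Rightarrow> complex"
  assumes [measurable]: "f \<in> borel_measurable borel"
  shows "(LINT t|weight_measure J w. f t) = (LINT t:support_of J|lborel. f t * of_real (w t))"
proof -
  let ?X = "real_of_ereal ` (fst ` J \<union> snd ` J)"
  have "(LINT t|weight_measure J w. f t) = (LINT t|lborel. weight_density J w t *\<^sub>R f t)"
    unfolding weight_measure_def by (subst integral_density) auto
  also have "\<dots> = (LINT t|lborel. indicator (support_of J) t *\<^sub>R (f t * of_real (w t)))"
  proof (rule integral_discrete_difference[of ?X])
    show "countable ?X" using finite_J by (intro countable_finite) simp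
    fix t assume t: "t \<notin> ?X"
    show "weight_density J w t *\<^sub>R f t = indicator (support_of J) t *\<^sub>R (f t * of_real (w t))"
    proof (cases "t \<in> (\<Union>(a, b)\<in>J. einterval a b)")
      case True
      then have "w t > 0" using interval_facts(4) by blast
      with True interior_subset_support show ?thesis
        by (auto simp: weight_density_def scaleR_conv_of_real indicator_def)
    next
      case False
      have "t \<notin> support_of J"
      proof
        assume "t \<in> support_of J"
        then obtain a b where ab: "(a, b) \<in> J" "a \<le> ereal t" "ereal t \<le> b"
          by (auto simp: support_of_def)
        with t have "a \<noteq> ereal t" "b \<noteq> ereal t" by force+
        with ab False show False by (force simp: einterval_iff less_le)
      qed
      with False show ?thesis by (simp add: weight_density_def)
    qed
  qed auto
  finally show ?thesis by (simp add: set_lebesgue_integral_def)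
qed

lemma measurable_poly_of_real [measurable]:
  "(\<lambda>t. poly p (complex_of_real t)) \<in> borel_measurable borel"
  by (intro borel_measurable_continuous_onI continuous_intros)

lemma set_integrable_weighted:
  assumes "(a, b) \<in> J" "z \<in> \<Omega>"
  shows "set_integrable lborel (einterval a b)
    (\<lambda>t. of_real (w t) * (poly q (of_real t) / (of_real t - z) ^ k))"
proof -
  let ?f = "\<lambda>t. poly q (complex_of_real t) / (of_real t - z) ^ k"
  have "integrable lborel (\<lambda>t. weight_density J w t *\<^sub>R ?f t)"
    using integrable_poly_div[OF assms(2), of q k] unfolding weight_measure_def
    by (subst (asm) integrable_density) auto
  then have "integrable lborel (\<lambda>t. indicator (einterval a b) t *\<^sub>R (weight_density J w t *\<^sub>R ?f t))"
    by (intro integrable_mult_indicator) auto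
  also have "(\<lambda>t. indicator (einterval a b) t *\<^sub>R (weight_density J w t *\<^sub>R ?f t))
      = (\<lambda>t. indicator (einterval a b) t *\<^sub>R (of_real (w t) * ?f t))"
  proof
    fix t
    show "indicator (einterval a b) t *\<^sub>R (weight_density J w t *\<^sub>R ?f t)
        = indicator (einterval a b) t *\<^sub>R (of_real (w t) * ?f t)"
    proof (cases "t \<in> einterval a b")
      case True
      with interval_facts(4)[OF assms(1) True] assms(1) show ?thesis
        by (auto simp: weight_density_def indicator_def scaleR_conv_of_real)
    qed simp
  qed
  finally show ?thesis unfolding set_integrable_def .
qed

text \<open>The integrand is the derivative of \<open>w A p / (t - z)\<close> by \<open>A w' = B w\<close>.\<close>
lemma integration_by_parts:
  assumes J: "(a, b) \<in> J" and z: "z \<in> \<Omega>"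
  shows "(LINT t:einterval a b|lborel. of_real (w t) *
    (poly (cpoly A * pderiv p + (pderiv (cpoly A) + cpoly B) * p) (of_real t) / (of_real t - z)
      - poly (cpoly A * p) (of_real t) / (of_real t - z)\<^sup>2)) = 0"
proof (rule integral_derivative_eq_0)
  let ?q = "cpoly A * pderiv p + (pderiv (cpoly A) + cpoly B) * p"
  let ?g = "\<lambda>t. complex_of_real (w t) * (poly (cpoly A * p) (of_real t) / (of_real t - z))"
  let ?g' = "\<lambda>t. complex_of_real (w t) * (poly ?q (of_real t) / (of_real t - z)
      - poly (cpoly A * p) (of_real t) / (of_real t - z)\<^sup>2)"
  note I = interval_facts[OF J]
  show ab: "a < b" by (rule I(1))
  have off: "of_real t - z \<noteq> 0" if "t \<in> einterval a b" for t
    using z that J interior_subset_support by (force simp: \<Omega>_def)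
  have dw: "(w has_real_derivative poly B t / poly A t * w t) (at t)" if "t \<in> einterval a b" for t
    by (rule has_real_derivative_of_upper_boundary_value[OF I(5)]) (use that I(3) in auto)
  show deriv: "(?g has_vector_derivative ?g' t) (at t)" if t: "t \<in> einterval a b" for t
  proof -
    let ?f = "\<lambda>x. poly (cpoly A * p) x / (x - z)"
    let ?f' = "(poly (pderiv (cpoly A * p)) (of_real t) * (of_real t - z) - poly (cpoly A * p) (of_real t))
          / (of_real t - z)\<^sup>2"
    have "(?f has_field_derivative ?f') (at (of_real t))"
      using off[OF t]
      by (auto intro!: derivative_eq_intros poly_DERIV simp: power2_eq_square simp del: poly_mult)
    then have "((\<lambda>t. ?f (of_real t)) has_vector_derivative ?f') (at t)"
      by (rule has_vector_derivative_real_field)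
    moreover have "((\<lambda>t. complex_of_real (w t)) has_vector_derivative of_real (poly B t / poly A t * w t)) (at t)"
      using dw[OF t] by (intro has_vector_derivative_of_real)
        (simp add: has_real_derivative_iff_has_vector_derivative)
    ultimately have "(?g has_vector_derivative
        of_real (w t) * ?f' + of_real (poly B t / poly A t * w t) * ?f (of_real t)) (at t)"
      by (intro has_vector_derivative_mult)
    moreover have "of_real (w t) * ?f' + of_real (poly B t / poly A t * w t) * ?f (of_real t) = ?g' t"
      using off[OF t] I(3)[OF t]
      by (simp add: pderiv_mult divide_simps power2_eq_square) (simp add: algebra_simps)
    ultimately show ?thesis by simp
  qed
  show cont: "continuous_on (einterval a b) ?g'"
    using off DERIV_isCont[OF dw] by (intro continuous_intros continuous_at_imp_continuous_on) auto
  have split: "?g' = (\<lambda>t. of_real (w t) * (poly ?q (of_real t) / (of_real t - z) ^ 1)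
      - of_real (w t) * (poly (cpoly A * p) (of_real t) / (of_real t - z) ^ 2))"
    by (simp add: right_diff_distrib)
  show int: "set_integrable lborel (einterval a b) ?g'"
    unfolding split by (intro set_integral_diff(1) set_integrable_weighted[OF J z])
  show "((?g \<circ> real_of_ereal) \<longlongrightarrow> 0) (at e within {a<..<b})" if e: "e \<in> {a, b}" for e
  proof (cases "\<bar>e\<bar> = \<infinity>")
    case True
    show ?thesis
    proof (rule tendsto_0_endpoint[OF ab e deriv cont int, where \<phi> = "\<lambda>t. t" and \<phi>' = "\<lambda>_. 1" and h = ?g])
      show "set_integrable lborel (einterval a b) ?g"
        using set_integrable_weighted[OF J z, of "cpoly A * p" 1] by simp
      show "filterlim ((\<lambda>t. t) \<circ> real_of_ereal) at_infinity (at e within {a<..<b})"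
      proof (cases "e = b")
        case e: True
        with True ab have "b = \<infinity>" by (cases b) auto
        then have "at e within {a<..<b} = filtermap ereal at_top"
          using ab e by (simp add: at_left_PInf flip: at_left_eq_at_within_Ioo)
        then show ?thesis
          by (simp add: filterlim_filtermap o_def filterlim_at_top_imp_at_infinity filterlim_ident)
      next
        case False
        with True ab e have "e = a" "a = -\<infinity>" by (cases a; auto)+
        then have "at e within {a<..<b} = filtermap ereal at_bot"
          using ab by (simp add: at_right_MInf flip: at_right_eq_at_within_Ioo)
        then show ?thesis
          by (simp add: filterlim_filtermap o_def filterlim_at_bot_imp_at_infinity filterlim_ident)
      qed
    qed (auto intro!: derivative_eq_intros)
  next
    case False
    then obtain r where r: "e = ereal r" by (cases e) auto
    with I(2)[OF e] have "poly A r = 0" by simp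
    then obtain Q where Q: "A = [:-r, 1:] * Q" by (auto simp: poly_eq_0_iff_dvd dvd_def)
    have ne: "t \<noteq> r" if "t \<in> einterval a b" for t using that e r by (auto simp: einterval_iff)
    let ?h = "\<lambda>t. 2 * (complex_of_real (w t) * (poly (cpoly Q * p) (of_real t) / (of_real t - z)))"
    show ?thesis
    proof (rule tendsto_0_endpoint[OF ab e deriv cont int,
          where \<phi> = "\<lambda>t. ln ((t - r)\<^sup>2)" and \<phi>' = "\<lambda>t. 2 / (t - r)" and h = ?h])
      show "set_integrable lborel (einterval a b) ?h"
        using set_integrable_weighted[OF J z, of "cpoly Q * p" 1]
        by (intro set_integrable_mult_right) simp
      show "((\<lambda>t. ln ((t - r)\<^sup>2)) has_real_derivative 2 / (t - r)) (at t)" if "t \<in> einterval a b" for t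
      proof -
        have "0 < (t - r) * (t - r)" using ne[OF that] by (simp flip: power2_eq_square)
        then show ?thesis by (auto intro!: derivative_eq_intros simp: power2_eq_square divide_simps)
      qed
      show "continuous_on (einterval a b) (\<lambda>t. 2 / (t - r))"
        using ne by (intro continuous_intros) auto
      show "norm (?g t) * \<bar>2 / (t - r)\<bar> \<le> norm (?h t)" if "t \<in> einterval a b" for t
      proof -
        have A: "poly A t = (t - r) * poly Q t" by (simp add: Q algebra_simps)
        have "norm (?g t) = \<bar>t - r\<bar> * norm (?h t) / 2"
          by (simp only: poly_mult poly_cpoly_of_real A of_real_mult) (simp add: norm_mult norm_divide del: of_real_diff)
        then show ?thesis using ne[OF that] by (simp add: abs_divide)
      qed
      have "filterlim (\<lambda>t. (t - r)\<^sup>2) (at_right 0) (at r)"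
        unfolding filterlim_at
        by (auto intro!: tendsto_eq_intros simp: eventually_at_filter)
      from filterlim_compose[OF ln_at_0 this]
      have "filterlim (\<lambda>t. ln ((t - r)\<^sup>2)) at_infinity (at r)"
        by (rule filterlim_at_bot_imp_at_infinity)
      then have "filterlim ((\<lambda>t. ln ((t - r)\<^sup>2)) \<circ> real_of_ereal) at_infinity (at e)"
        by (simp add: r at_ereal filterlim_filtermap o_def)
      then show "filterlim ((\<lambda>t. ln ((t - r)\<^sup>2)) \<circ> real_of_ereal) at_infinity (at e within {a<..<b})"
        by (rule filterlim_mono) (auto intro: at_le)
    qed
  qed
qed

sublocale pearson_measure "weight_measure J w" "support_of J" "cpoly A" "cpoly B"
proof
  fix p z assume z: "z \<in> \<Omega>"
  let ?f = "\<lambda>t. poly (cpoly A * pderiv p + (pderiv (cpoly A) + cpoly B) * p) (of_real t) / (of_real t - z)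
      - poly (cpoly A * p) (of_real t) / (of_real t - z)\<^sup>2"
  let ?I = "\<lambda>(a, b). einterval a b"
  have wf: "set_integrable lborel (?I i) (\<lambda>t. of_real \<bar>w t\<bar> * ?f t)"
    "(LINT t:?I i|lborel. of_real \<bar>w t\<bar> * ?f t) = 0" if i: "i \<in> J" for i
  proof -
    obtain a b where ab: "i = (a, b)" by (cases i)
    have J: "(a, b) \<in> J" using i ab by simp
    have eq: "complex_of_real \<bar>w t\<bar> * ?f t = of_real (w t) * ?f t" if "t \<in> einterval a b" for t
      using interval_facts(4)[OF J that] by simp
    have "set_integrable lborel (einterval a b)
      (\<lambda>t. of_real (w t) * (poly (cpoly A * pderiv p + (pderiv (cpoly A) + cpoly B) * p) (of_real t) / (of_real t - z) ^ 1)
      - of_real (w t) * (poly (cpoly A * p) (of_real t) / (of_real t - z) ^ 2))"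
      by (intro set_integral_diff(1) set_integrable_weighted[OF J z])
    then have "set_integrable lborel (einterval a b) (\<lambda>t. of_real (w t) * ?f t)"
      by (simp add: right_diff_distrib)
    moreover have "set_integrable lborel (einterval a b) (\<lambda>t. of_real \<bar>w t\<bar> * ?f t) \<longleftrightarrow>
        set_integrable lborel (einterval a b) (\<lambda>t. of_real (w t) * ?f t)"
      by (rule set_integrable_cong[OF refl refl eq])
    ultimately show "set_integrable lborel (?I i) (\<lambda>t. of_real \<bar>w t\<bar> * ?f t)"
      unfolding ab prod.case by blast
    have "(LINT t:einterval a b|lborel. of_real \<bar>w t\<bar> * ?f t)
        = (LINT t:einterval a b|lborel. of_real (w t) * ?f t)"
    proof (rule set_lebesgue_integral_cong)
      show "\<forall>t. t \<in> einterval a b \<longrightarrow> complex_of_real \<bar>w t\<bar> * ?f t = of_real (w t) * ?f t"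
        using eq by blast
    qed simp
    then show "(LINT t:?I i|lborel. of_real \<bar>w t\<bar> * ?f t) = 0"
      unfolding ab prod.case using integration_by_parts[OF J z, of p] by (rule trans)
  qed
  have "?f \<in> borel_measurable borel" by measurable
  then have "(LINT t|weight_measure J w. ?f t) = (LINT t|lborel. weight_density J w t *\<^sub>R ?f t)"
    unfolding weight_measure_def by (intro integral_density) simp_all
  also have "\<dots> = (LINT t:(\<Union>i\<in>J. ?I i)|lborel. of_real \<bar>w t\<bar> * ?f t)"
    unfolding set_lebesgue_integral_def weight_density_def
    by (simp only: scaleR_conv_of_real of_real_mult mult.assoc)
  also have "\<dots> = (\<Sum>i\<in>J. LINT t:?I i|lborel. of_real \<bar>w t\<bar> * ?f t)"
    using finite_J wf(1) weight
    by (intro set_integral_finite_Union) (auto simp: semiclassical_weight_def)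
  also have "\<dots> = 0" using wf(2) by simp
  finally show "(LINT t|weight_measure J w. ?f t) = 0" .
qed

lemma cauchy_transform_eq_cauchy: "cauchy_transform (support_of J) w (poly p) = \<CC> p"
proof
  fix z
  have "\<CC> p z = (LINT t:support_of J|lborel. poly p (of_real t) / (of_real t - z) * of_real (w t))"
    unfolding \<CC>_def by (rule integral_weight_measure) measurable
  then show "cauchy_transform (support_of J) w (poly p) z = \<CC> p z"
    by (simp add: cauchy_transform_def)
qed

lemma electrostatic_partner_eq:
  assumes "z \<in> \<Omega>"
  shows "electrostatic_partner A B (support_of J) w p z =
    poly p z * (poly (cpoly A) z * \<CC>' p z - poly (cpoly B) z * \<CC> p z)
      - poly (cpoly A * pderiv p) z * \<CC> p z"
  unfolding electrostatic_partner_def Let_def cauchy_transform_eq_cauchy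
    DERIV_imp_deriv[OF has_field_derivative_cauchy[OF assms]]
  by (simp add: det_2 algebra_simps)

end

section \<open>Electrostatic partners of multiple orthogonal polynomials\<close>

text \<open>The two weights of the multiple orthogonality do not interact: for each of them \<open>P\<close> is a
  polynomial of degree \<open>N\<close> that is orthogonal to the first \<open>n\<close> powers.\<close>
theorem single_weight_ode:
  fixes P :: "complex poly"
  assumes weight: "semiclassical_weight A B J w"
    and \<sigma>: "\<sigma> = semiclassical_class A B" "\<sigma> \<ge> 0"
    and P: "P \<noteq> 0" "degree P = N" and n: "n \<le> N"
    and orth: "\<And>j. j < n \<Longrightarrow>
      (LINT x:support_of J|lborel. of_real x ^ j * poly P (of_real x) * of_real (w x)) = 0"
  shows "\<exists>S C :: complex poly.
      (\<forall>z. z \<notin> complex_of_real ` support_of J \<longrightarrow>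
         poly S z = electrostatic_partner A B (support_of J) w P z) \<and>
      int (degree S) \<le> int N - int n + \<sigma> \<and>
      int (degree C) \<le> int N - int n + 2 * \<sigma> \<and>
      cpoly A * S * pderiv (pderiv P)
        + (cpoly (pderiv A) * S - cpoly A * pderiv S + cpoly B * S) * pderiv P
        + C * P = 0"
proof -
  interpret semiclassical A B J w by unfold_locales (rule weight)
  have cpoly_pderiv: "cpoly (pderiv A) = pderiv (cpoly A)"
    by (rule poly_eqI) (simp add: coeff_pderiv coeff_map_poly)
  obtain S Q where S: "\<And>z. z \<in> \<Omega> \<Longrightarrow> poly S z = poly P z * (poly (cpoly A) z * \<CC>' P z - poly (cpoly B) z * \<CC> P z)
      - poly (cpoly A * pderiv P) z * \<CC> P z"
    and ode: "cpoly A * S * pderiv (pderiv P)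
        + (pderiv (cpoly A) * S - cpoly A * pderiv S + cpoly B * S) * pderiv P + Q * P = 0"
    using electrostatic_ode[of P] by blast
  have dA: "int (degree (cpoly A)) \<le> \<sigma> + 2" and dB: "int (degree (cpoly B)) \<le> \<sigma> + 1"
    using \<sigma>(1) by (auto simp: semiclassical_class_def degree_map_poly)
  have orth': "(LINT t|weight_measure J w. of_real t ^ j * poly P (of_real t)) = 0" if "j < n" for j
    using orth[OF that] by (subst integral_weight_measure) auto
  \<comment> \<open>\<open>A\<close> and \<open>B\<close> have degrees at most \<open>\<sigma> + 2\<close> and \<open>\<sigma> + 1\<close>.\<close>
  have "degree (monom 1 (Suc n) * S) \<le> N + (nat \<sigma> + 1)"
    by (rule degree_electrostatic_partner[OF _ _ _ orth' S]) (use P(2) dA dB \<sigma>(2) in auto)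
  then have dS: "int (degree S) \<le> int N - int n + \<sigma>"
    using n \<sigma>(2) by (cases "S = 0") (auto simp: degree_mult_eq degree_monom_eq)
  have "int (degree Q) \<le> (int N - int n + \<sigma>) + \<sigma>"
    using n \<sigma>(2) by (intro degree_ode_coefficient[OF ode P(1) dA dB dS]) auto
  moreover have "poly S z = electrostatic_partner A B (support_of J) w P z"
    if "z \<notin> complex_of_real ` support_of J" for z
    using S[of z] electrostatic_partner_eq[of z P] that by (simp add: \<Omega>_def)
  ultimately show ?thesis using dS ode cpoly_pderiv by (intro exI[of _ S] exI[of _ Q]) auto
qed

theorem theorem5p2:
  fixes A B :: "nat \<Rightarrow> real poly"
    and J :: "nat \<Rightarrow> (ereal \<times> ereal) set"
    and \<Delta> :: "nat \<Rightarrow> real set"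
    and w :: "nat \<Rightarrow> real \<Rightarrow> real"
    and \<sigma> :: "nat \<Rightarrow> int"
    and n :: "nat \<Rightarrow> nat"
    and N :: nat
    and P :: "complex poly"
  assumes weight: "\<And>i. i \<in> {1, 2} \<Longrightarrow> semiclassical_weight (A i) (B i) (J i) (w i)"
    and Delta: "\<And>i. i \<in> {1, 2} \<Longrightarrow> \<Delta> i = support_of (J i)"
    and sigma: "\<And>i. i \<in> {1, 2} \<Longrightarrow> \<sigma> i = semiclassical_class (A i) (B i)"
    and sigma_nonneg: "\<And>i. i \<in> {1, 2} \<Longrightarrow> \<sigma> i \<ge> 0"
    and N: "N = n 1 + n 2"
    and monic: "lead_coeff P = 1"
    and degree: "degree P = N"
    and orth: "\<And>i j. i \<in> {1, 2} \<Longrightarrow> j < n i \<Longrightarrow>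
      (LINT x:\<Delta> i|lborel. of_real x ^ j * poly P (of_real x) * of_real (w i x)) = 0"
    and nonorth: "\<And>i. i \<in> {1, 2} \<Longrightarrow>
      (LINT x:\<Delta> i|lborel. of_real x ^ n i * poly P (of_real x) * of_real (w i x)) \<noteq> 0"
    and wronskian: "wronskian_not_identically_zero A B \<Delta> w P"
  shows "\<forall>i\<in>{1, 2}. \<exists>S C :: complex poly.
      (\<forall>z. z \<notin> complex_of_real ` \<Delta> i \<longrightarrow>
         poly S z = electrostatic_partner (A i) (B i) (\<Delta> i) (w i) P z) \<and>
      int (degree S) \<le> int N - int (n i) + \<sigma> i \<and>
      int (degree C) \<le> int N - int (n i) + 2 * \<sigma> i \<and>
      cpoly (A i) * S * pderiv (pderiv P)
        + (cpoly (pderiv (A i)) * S - cpoly (A i) * pderiv S + cpoly (B i) * S) * pderiv P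
        + C * P = 0"
proof
  fix i :: nat assume i: "i \<in> {1, 2}"
  have "P \<noteq> 0" using monic by auto
  moreover have "n i \<le> N" using i N by auto
  ultimately show "\<exists>S C :: complex poly.
      (\<forall>z. z \<notin> complex_of_real ` \<Delta> i \<longrightarrow>
         poly S z = electrostatic_partner (A i) (B i) (\<Delta> i) (w i) P z) \<and>
      int (degree S) \<le> int N - int (n i) + \<sigma> i \<and>
      int (degree C) \<le> int N - int (n i) + 2 * \<sigma> i \<and>
      cpoly (A i) * S * pderiv (pderiv P)
        + (cpoly (pderiv (A i)) * S - cpoly (A i) * pderiv S + cpoly (B i) * S) * pderiv P
        + C * P = 0"
    using weight[OF i] sigma[OF i] sigma_nonneg[OF i] degree orth[OF i] unfolding Delta[OF i]
    by (intro single_weight_ode) auto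
qed

end
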